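(* Let $n\ge 1$, let $\mathfrak{S}_{n+1}$ be the symmetric group on $\{1,\dots,n+1\}$ and let $c=(1,2,\dots,n+1)$. There is a bijection $\varphi_A:\alpha\mapsto \mathbf{w}$, $\mathbf{w}: e=\omega_0<\omega_1<\cdots<\omega_n=c$, between the set $\mathrm{PF}^A_n$ of parking functions (of type $A$) of size $n$ and the set of maximal chains in $\mathrm{NC}(\mathfrak{S}_{n+1},c)$ such that for each $i\in\{1,\dots,n\}$ the $i$th car of $\alpha$ is reluctant if and only if $(\omega_{i-1},\omega_i)$ is a bad edge.
   Context: Parking functions of type $A$: there are $n$ parking spaces $1,\dots,n$ along a one-way street and cars $C_1,\dots,C_n$ with preferred spaces $a_1,\dots,a_n\in\{1,\dots,n\}$. Cars arrive in order; each car parks at its preferred space if it is free, and otherwise moves on and parks at the next available (larger-numbered) space; if none exists it leaves without parking. The list $\alpha=(a_1,\dots,a_n)$ is a parking function (of type $A$) of size $n$ if all cars park. If $C_i$ parks at space $p_i$, then $C_i$ is lucky if $p_i=a_i$ and reluctant if $p_i\ne a_i$. Noncrossing partition lattice: in $W=\mathfrak{S}_{n+1}$ let $S=\{(i,i+1):1\le i\le n\}$ be the simple generators and $T$ the set of all transpositions (the reflections). The product $\sigma\tau$ means: first apply $\tau$, then $\sigma$. Let $\ell_S(\omega)$ (resp. $\ell_T(\omega)$) be the minimal number of factors in an expression of $\omega$ as a product of elements of $S$ (resp. $T$). The absolute order $\le$ is: $\omega<\omega'$ iff $\omega\neq\omega'$ and $\ell_T(\omega')=\ell_T(\omega)+\ell_T(\omega^{-1}\omega')$.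 Then $\mathrm{NC}(W,c)=\{\omega\in W: e\le\omega\le c\}$ with the absolute order. The (strong) Bruhat order $\le_B$ is the partial order generated by $\omega<_B\omega t$ for $t\in T$ with $\ell_S(\omega)<\ell_S(\omega t)$. An edge is a pair $(\mu,\nu)$ of elements of $\mathrm{NC}(W,c)$ such that $\nu$ covers $\mu$ in the absolute order; it is good if $\mu<_B\nu$ and bad if $\mu>_B\nu$. *)

theory Defs
  imports Main "HOL-Combinatorics.Combinatorics"
begin

text \<open>
  Cars and spaces are numbered from 1, list positions from 0: car \<open>i\<close> has preference
  \<open>\<alpha> ! (i - 1)\<close>.
\<close>

definition park_at :: "nat \<Rightarrow> nat set \<Rightarrow> nat \<Rightarrow> nat option" where
  "park_at n occ a =
     (if \<exists>p\<in>{1..n} - occ. a \<le> p then Some (LEAST p. p \<in> {1..n} - occ \<and> a \<le> p) else None)"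

text \<open>Outcomes in order of arrival; \<open>None\<close> means that the car leaves without parking.\<close>

fun park_cars :: "nat \<Rightarrow> nat set \<Rightarrow> nat list \<Rightarrow> nat option list" where
  "park_cars n occ [] = []"
| "park_cars n occ (a # as) =
     park_at n occ a # park_cars n (occ \<union> set_option (park_at n occ a)) as"

definition parking_functions :: "nat \<Rightarrow> nat list set" where
  "parking_functions n =
     {\<alpha>. length \<alpha> = n \<and> set \<alpha> \<subseteq> {1..n} \<and> None \<notin> set (park_cars n {} \<alpha>)}"

definition reluctant :: "nat list \<Rightarrow> nat \<Rightarrow> bool" where
  "reluctant \<alpha> i \<longleftrightarrow>
     (\<exists>p. park_cars (length \<alpha>) {} \<alpha> ! (i - 1) = Some p \<and> p \<noteq> \<alpha> ! (i - 1))"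

text \<open>
  The parameter \<open>n\<close> is the rank, so the group is the symmetric group on \<open>{1..n + 1}\<close>. The
  product of \<open>\<sigma>\<close> and \<open>\<tau>\<close> is \<open>\<sigma> \<circ> \<tau>\<close>.
\<close>

definition Sym :: "nat \<Rightarrow> (nat \<Rightarrow> nat) set" where
  "Sym n = {w. w permutes {1..n + 1}}"

definition simple_gens :: "nat \<Rightarrow> (nat \<Rightarrow> nat) set" where
  "simple_gens n = {transpose i (i + 1) | i. 1 \<le> i \<and> i \<le> n}"

definition reflections :: "nat \<Rightarrow> (nat \<Rightarrow> nat) set" where
  "reflections n = {transpose i j | i j. 1 \<le> i \<and> i < j \<and> j \<le> n + 1}"

definition long_cycle :: "nat \<Rightarrow> nat \<Rightarrow> nat" where
  "long_cycle n = cycle_of_list [1..<n + 2]"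

definition word_len :: "(nat \<Rightarrow> nat) set \<Rightarrow> (nat \<Rightarrow> nat) \<Rightarrow> nat" where
  "word_len G w = (LEAST k. \<exists>us. set us \<subseteq> G \<and> length us = k \<and> foldr (\<circ>) us id = w)"

definition abs_less :: "nat \<Rightarrow> (nat \<Rightarrow> nat) \<Rightarrow> (nat \<Rightarrow> nat) \<Rightarrow> bool" where
  "abs_less n w w' \<longleftrightarrow>
     w \<in> Sym n \<and> w' \<in> Sym n \<and> w \<noteq> w' \<and>
     word_len (reflections n) w' =
       word_len (reflections n) w + word_len (reflections n) (inv w \<circ> w')"

definition abs_le :: "nat \<Rightarrow> (nat \<Rightarrow> nat) \<Rightarrow> (nat \<Rightarrow> nat) \<Rightarrow> bool" where
  "abs_le n w w' \<longleftrightarrow> abs_less n w w' \<or> w = w'"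

definition abs_covers :: "nat \<Rightarrow> (nat \<Rightarrow> nat) \<Rightarrow> (nat \<Rightarrow> nat) \<Rightarrow> bool" where
  "abs_covers n \<nu> \<mu> \<longleftrightarrow> abs_less n \<mu> \<nu> \<and> \<not> (\<exists>w. abs_less n \<mu> w \<and> abs_less n w \<nu>)"

definition NC :: "nat \<Rightarrow> (nat \<Rightarrow> nat) \<Rightarrow> (nat \<Rightarrow> nat) set" where
  "NC n c = {w \<in> Sym n. abs_le n id w \<and> abs_le n w c}"

definition bruhat_step :: "nat \<Rightarrow> (nat \<Rightarrow> nat) \<Rightarrow> (nat \<Rightarrow> nat) \<Rightarrow> bool" where
  "bruhat_step n w w' \<longleftrightarrow>
     w \<in> Sym n \<and>
     (\<exists>t\<in>reflections n. w' = w \<circ> t \<and> word_len (simple_gens n) w < word_len (simple_gens n) (w \<circ> t))"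

definition bruhat_le :: "nat \<Rightarrow> (nat \<Rightarrow> nat) \<Rightarrow> (nat \<Rightarrow> nat) \<Rightarrow> bool" where
  "bruhat_le n = (bruhat_step n)\<^sup>*\<^sup>*"

definition bruhat_less :: "nat \<Rightarrow> (nat \<Rightarrow> nat) \<Rightarrow> (nat \<Rightarrow> nat) \<Rightarrow> bool" where
  "bruhat_less n w w' \<longleftrightarrow> bruhat_le n w w' \<and> w \<noteq> w'"

definition edge :: "nat \<Rightarrow> (nat \<Rightarrow> nat) \<Rightarrow> (nat \<Rightarrow> nat) \<Rightarrow> (nat \<Rightarrow> nat) \<Rightarrow> bool" where
  "edge n c \<mu> \<nu> \<longleftrightarrow> \<mu> \<in> NC n c \<and> \<nu> \<in> NC n c \<and> abs_covers n \<nu> \<mu>"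

definition bad_edge :: "nat \<Rightarrow> (nat \<Rightarrow> nat) \<Rightarrow> (nat \<Rightarrow> nat) \<Rightarrow> (nat \<Rightarrow> nat) \<Rightarrow> bool" where
  "bad_edge n c \<mu> \<nu> \<longleftrightarrow> edge n c \<mu> \<nu> \<and> bruhat_less n \<nu> \<mu>"

text \<open>
  A maximal chain is recorded by its increasing enumeration. The predicate
  \<open>pred_on.maxchain A P\<close> is inclusion-maximality among the chains in \<open>A\<close> for the reflexive
  closure of \<open>P\<close>; nothing about length or endpoints is built in.
\<close>

definition maximal_chains :: "nat \<Rightarrow> (nat \<Rightarrow> nat) \<Rightarrow> (nat \<Rightarrow> nat) list set" where
  "maximal_chains n c =
     {ws. sorted_wrt (abs_less n) ws \<and> pred_on.maxchain (NC n c) (abs_less n) (set ws)}"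

end

theory Submission
  imports Defs
begin

text \<open>
  Both kinds of objects are taken apart from the end, and the two decompositions agree.

  Undo the last car. It frees a space \<open>p\<close> inside a maximal run of \<open>m\<close> consecutive occupied
  spaces and leaves runs of lengths \<open>k\<close> and \<open>m - 1 - k\<close>. The car arrives at \<open>p\<close> from \<open>k + 1\<close>
  preferences, namely \<open>p\<close> itself, where it is lucky, and the \<open>k\<close> spaces of the left run, where
  it is reluctant.

  Go down one edge of the noncrossing partition lattice. A block with \<open>m + 1\<close> elements splits
  into an interval of its elements with \<open>m - k\<close> members and the remaining \<open>k + 1\<close> elements,
  which include the minimum. There are \<open>k + 1\<close> such intervals. The edge is good if the interval
  reaches the maximum of the block, and bad in the \<open>k\<close> other cases, in which it is nested inside
  the other part.

  So count \<open>n + 1\<close> as a free space, and in front of every free space a run, possibly empty. If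
  the runs and the blocks agree in size, up to the shift by one, then the ways back correspond,
  kind by kind, and lead to situations that agree again. The full street and the long cycle
  agree, since each has one run or block, and induction on the number of occupied spaces yields
  the bijection (\<open>parkings_refl_chains_bij\<close>).

  The correspondence between runs and blocks is carried by a permutation \<open>\<beta>\<close> of \<open>{1..n + 1}\<close>. A
  set \<open>occ\<close> of occupied spaces has the permutation \<open>run_cycles occ\<close>, whose cycles are the runs
  with the free space behind them, and \<open>w\<close> is its conjugate under \<open>\<beta>\<close>, where \<open>\<beta>\<close> increases along
  each run. The ways back are indexed on both sides by the pairs \<open>i < j\<close> in the same cycle of
  \<open>run_cycles occ\<close>. If \<open>e\<close> is the end of this cycle, the pair stands for a car with preference
  \<open>i\<close> parking at \<open>i + e - j\<close>, and for multiplication of \<open>w\<close> by the reflection \<open>(\<beta> i \<beta> j)\<close>. The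
  case \<open>j = e\<close> is the lucky car and the good edge.

  Three facts about the symmetric group connect this with the orders. Maximal chains are the
  sequences of reflection steps from the identity to \<open>c\<close> in which the length grows by one
  (\<open>maximal_chains_eq_refl_chains\<close>). The elements one step below \<open>w\<close> are the products of \<open>w\<close>
  with a reflection inside a cycle (\<open>run_labelling_refl_step\<close>, \<open>refl_step_run_labelling\<close>). An
  edge is compared in the Bruhat order by looking at two values (\<open>bruhat_less_transpose_iff\<close>),
  as the exchange property shows.
\<close>

section \<open>Words and generators\<close>

primrec word_prod :: "('a \<Rightarrow> 'a) list \<Rightarrow> 'a \<Rightarrow> 'a" where
  "word_prod [] = id"
| "word_prod (u # us) = u \<circ> word_prod us"

lemma word_len_word_prod:
  "word_len G w = (LEAST k. \<exists>us. set us \<subseteq> G \<and> length us = k \<and> word_prod us = w)"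
proof -
  have "foldr (\<circ>) us id = word_prod us" for us :: "(nat \<Rightarrow> nat) list"
    by (induction us) simp_all
  then show ?thesis unfolding word_len_def by simp
qed

lemma word_prod_append: "word_prod (us @ vs) = word_prod us \<circ> word_prod vs"
  by (induction us) (simp_all add: comp_assoc)

lemma word_len_le: "set us \<subseteq> G \<Longrightarrow> word_len G (word_prod us) \<le> length us"
  unfolding word_len_word_prod by (rule Least_le) blast

lemma word_len_attained:
  assumes "set vs \<subseteq> G" "word_prod vs = w"
  obtains us where "set us \<subseteq> G" "length us = word_len G w" "word_prod us = w"
proof -
  have "\<exists>us. set us \<subseteq> G \<and> length us = word_len G w \<and> word_prod us = w"
    unfolding word_len_word_prod by (rule LeastI[where k = "length vs"]) (use assms in blast)
  then show ?thesis using that by blast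
qed

lemma transpose_conj_adjacent:
  fixes i j :: nat
  assumes "i < j"
  shows "transpose i (Suc j) = transpose j (Suc j) \<circ> transpose i j \<circ> transpose j (Suc j)"
  using assms by (auto simp: transpose_def fun_eq_iff)

text \<open>
  A reflection moves one value past its neighbours: conjugating \<open>(i j)\<close> by the simple generator
  \<open>(j j+1)\<close> gives \<open>(i j+1)\<close>.
\<close>

lemma transpose_simple_word:
  assumes "1 \<le> i" "i < j" "j \<le> n + 1"
  shows "\<exists>us. set us \<subseteq> simple_gens n \<and> word_prod us = transpose i j"
  using assms(2,3)
proof (induction j)
  case (Suc j)
  have g: "transpose j (Suc j) \<in> simple_gens n" if "1 \<le> j"
    using that Suc.prems unfolding simple_gens_def by auto
  show ?case
  proof (cases "i = j")
    case True
    then show ?thesis using g assms(1) by (intro exI[of _ "[transpose j (Suc j)]"]) auto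
  next
    case False
    then obtain us where us: "set us \<subseteq> simple_gens n" "word_prod us = transpose i j"
      using Suc by auto
    let ?s = "transpose j (Suc j)"
    have "word_prod (?s # us @ [?s]) = transpose i (Suc j)"
      using transpose_conj_adjacent[of i j] False Suc.prems
      by (simp add: word_prod_append us(2) comp_assoc)
    then show ?thesis using us g assms(1) False Suc.prems
      by (intro exI[of _ "?s # us @ [?s]"]) auto
  qed
qed simp

lemma Sym_simple_word:
  assumes "w \<in> Sym n"
  shows "\<exists>us. set us \<subseteq> simple_gens n \<and> word_prod us = w"
proof -
  have "w permutes {1..n + 1}" using assms by (simp add: Sym_def)
  moreover have "finite {1..n + 1}" by simp
  ultimately show ?thesis
  proof (induction w rule: permutes_induct)
    case id
    then show ?case by (intro exI[of _ "[]"]) auto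
  next
    case (swap a b p)
    then obtain us where us: "set us \<subseteq> simple_gens n" "word_prod us = p" by blast
    have "\<exists>vs. set vs \<subseteq> simple_gens n \<and> word_prod vs = transpose a b"
      using transpose_simple_word[of a b n] transpose_simple_word[of b a n] swap
      by (cases a b rule: linorder_cases) (auto simp: transpose_commute)
    then obtain vs where "set vs \<subseteq> simple_gens n" "word_prod vs = transpose a b" by blast
    with us show ?case by (intro exI[of _ "vs @ us"]) (simp add: word_prod_append)
  qed
qed

lemma simple_gens_subset: "simple_gens n \<subseteq> reflections n"
  unfolding simple_gens_def reflections_def by force

lemma reflections_subset_Sym: "reflections n \<subseteq> Sym n"
  unfolding Sym_def reflections_def by (auto intro!: permutes_swap_id)

lemma reflectionI:
  assumes "a \<in> {1..n + 1}" "b \<in> {1..n + 1}" "a \<noteq> b"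
  shows "transpose a b \<in> reflections n"
  using assms unfolding reflections_def
  by (cases a b rule: linorder_cases) (auto, metis transpose_commute)

lemma Sym_comp: "u \<in> Sym n \<Longrightarrow> w \<in> Sym n \<Longrightarrow> u \<circ> w \<in> Sym n"
  unfolding Sym_def by (auto intro: permutes_compose)

lemma Sym_inv: "w \<in> Sym n \<Longrightarrow> inv w \<in> Sym n"
  unfolding Sym_def by (auto intro: permutes_inv)

lemma Sym_id: "id \<in> Sym n"
  unfolding Sym_def by (auto intro: permutes_id)

lemma Sym_inv_left: "w \<in> Sym n \<Longrightarrow> inv w \<circ> w = id"
  unfolding Sym_def by (auto dest: permutes_inv_o)

lemma Sym_inv_right: "w \<in> Sym n \<Longrightarrow> w \<circ> inv w = id"
  unfolding Sym_def by (auto dest: permutes_inv_o)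

lemma Sym_cancel: "u \<in> Sym n \<Longrightarrow> u \<circ> (inv u \<circ> w) = w"
  by (metis Sym_inv_right comp_assoc id_comp)

lemma Sym_cancel': "u \<in> Sym n \<Longrightarrow> inv u \<circ> (u \<circ> w) = w"
  by (metis Sym_inv_left comp_assoc id_comp)

section \<open>Bruhat order\<close>

lemma transpose_adjacent_flip:
  fixes x y :: nat
  assumes "x < y" "transpose k (Suc k) x > transpose k (Suc k) y"
  shows "x = k" "y = Suc k"
  using assms by (auto simp: transpose_def split: if_splits)

text \<open>
  The strong exchange property. Apply the letters of the word one after the other, starting with
  the last, and follow the images of \<open>a\<close> and \<open>b\<close>. Their order is reversed at the end, so some
  letter reverses it; a simple generator reverses the order of two values only by interchanging
  them, hence deleting this letter has the effect of multiplying by \<open>(a b)\<close> on the right.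
\<close>

lemma exchange:
  assumes "set us \<subseteq> simple_gens n" "a < b" "word_prod us a > word_prod us b"
  shows "\<exists>vs. set vs \<subseteq> simple_gens n \<and> length vs < length us \<and>
    word_prod vs = word_prod us \<circ> transpose a b"
  using assms(1,3)
proof (induction us)
  case Nil
  then show ?case using assms(2) by simp
next
  case (Cons s us)
  let ?w = "word_prod us"
  show ?case
  proof (cases "?w a > ?w b")
    case True
    then obtain vs where "set vs \<subseteq> simple_gens n" "length vs < length us"
      "word_prod vs = ?w \<circ> transpose a b"
      using Cons.IH Cons.prems(1) by force
    then show ?thesis using Cons.prems
      by (intro exI[of _ "s # vs"]) (auto simp: comp_assoc)
  next
    case False
    obtain k where s: "s = transpose k (Suc k)"
      using Cons.prems unfolding simple_gens_def by auto
    have "?w a \<noteq> ?w b" using Cons.prems(2) by auto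
    with False have lt: "?w a < ?w b" by simp
    have "?w a = k" "?w b = Suc k"
      using transpose_adjacent_flip[OF lt, of k] Cons.prems(2) s by auto
    moreover have "inj ?w"
    proof -
      have "set us \<subseteq> Sym n"
        using Cons.prems simple_gens_subset reflections_subset_Sym by fastforce
      then have "?w \<in> Sym n" by (induction us) (auto intro: Sym_comp Sym_id)
      then show ?thesis by (auto simp: Sym_def permutes_inj)
    qed
    ultimately have "s (?w x) = ?w (transpose a b x)" for x
      using s inj_eq[of ?w x a] inj_eq[of ?w x b]
      by (cases "x = a"; cases "x = b") simp_all
    then have "s \<circ> ?w = ?w \<circ> transpose a b" by (simp add: fun_eq_iff)
    then have "word_prod us = word_prod (s # us) \<circ> transpose a b"
      by (simp add: comp_assoc)
    moreover have "set us \<subseteq> simple_gens n" "length us < length (s # us)"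
      using Cons.prems by simp_all
    ultimately show ?thesis by blast
  qed
qed

lemma simple_len_decreases:
  assumes "w \<in> Sym n" "a < b" "w a > w b"
  shows "word_len (simple_gens n) (w \<circ> transpose a b) < word_len (simple_gens n) w"
proof -
  obtain us where us: "set us \<subseteq> simple_gens n" "length us = word_len (simple_gens n) w"
    "word_prod us = w"
    using Sym_simple_word[OF assms(1)] word_len_attained by metis
  then obtain vs where "set vs \<subseteq> simple_gens n" "length vs < length us"
    "word_prod vs = w \<circ> transpose a b"
    using exchange[OF us(1) assms(2)] assms(3) by auto
  then show ?thesis using word_len_le[of vs "simple_gens n"] us(2) by simp
qed

lemma bruhat_le_len:
  "bruhat_le n u w \<Longrightarrow> u \<noteq> w \<Longrightarrow>
    word_len (simple_gens n) u < word_len (simple_gens n) w"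
proof -
  have "u = w \<or> word_len (simple_gens n) u < word_len (simple_gens n) w" if "bruhat_le n u w"
    using that unfolding bruhat_le_def
    by (induction rule: rtranclp_induct) (auto simp: bruhat_step_def)
  then show "bruhat_le n u w \<Longrightarrow> u \<noteq> w \<Longrightarrow>
    word_len (simple_gens n) u < word_len (simple_gens n) w" by blast
qed

text \<open>
  This reduces the Bruhat comparison along an edge, hence its being good or bad, to the
  comparison of two values.
\<close>

lemma bruhat_less_transpose_iff:
  assumes w: "w \<in> Sym n" and ab: "a \<in> {1..n + 1}" "b \<in> {1..n + 1}" "a < b"
  shows "bruhat_less n w (w \<circ> transpose a b) \<longleftrightarrow> w a < w b"
proof
  let ?t = "transpose a b"
  have t: "?t \<in> reflections n" using ab reflectionI[of a n b] by auto
  have wt: "w \<circ> ?t \<in> Sym n" using w t reflections_subset_Sym Sym_comp by blast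
  have inj: "inj w" using w by (auto simp: Sym_def permutes_inj)
  show "w a < w b" if "bruhat_less n w (w \<circ> ?t)"
  proof (rule ccontr)
    assume "\<not> w a < w b"
    then have "w a > w b" using inj ab by (metis injD linorder_neqE_nat nat_neq_iff)
    then show False
      using simple_len_decreases[OF w ab(3)] bruhat_le_len[of n w "w \<circ> ?t"] that
      unfolding bruhat_less_def by auto
  qed
  show "bruhat_less n w (w \<circ> ?t)" if "w a < w b"
  proof -
    have "word_len (simple_gens n) w < word_len (simple_gens n) (w \<circ> ?t)"
      using simple_len_decreases[OF wt ab(3)] that by (simp add: comp_assoc)
    then show ?thesis
      using w t unfolding bruhat_less_def bruhat_le_def bruhat_step_def by auto
  qed
qed

section \<open>Absolute order\<close>

abbreviation refl_len :: "nat \<Rightarrow> (nat \<Rightarrow> nat) \<Rightarrow> nat" where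
  "refl_len n \<equiv> word_len (reflections n)"

lemma refl_word:
  assumes "w \<in> Sym n"
  obtains us where "set us \<subseteq> reflections n" "length us = refl_len n w" "word_prod us = w"
  using Sym_simple_word[OF assms] simple_gens_subset word_len_attained
  by (metis order_trans)

lemma refl_len_id: "refl_len n id = 0"
  using word_len_le[of "[]" "reflections n"] by simp

lemma refl_len_eq_0: "w \<in> Sym n \<Longrightarrow> refl_len n w = 0 \<Longrightarrow> w = id"
  by (rule refl_word[of w n]) auto

lemma refl_len_refl: "t \<in> reflections n \<Longrightarrow> refl_len n t \<le> 1"
  using word_len_le[of "[t]" "reflections n"] by simp

lemma refl_len_comp:
  assumes "u \<in> Sym n" "w \<in> Sym n"
  shows "refl_len n (u \<circ> w) \<le> refl_len n u + refl_len n w"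
proof -
  obtain us where us: "set us \<subseteq> reflections n" "length us = refl_len n u" "word_prod us = u"
    using refl_word assms by blast
  obtain vs where vs: "set vs \<subseteq> reflections n" "length vs = refl_len n w" "word_prod vs = w"
    using refl_word assms by blast
  show ?thesis using word_len_le[of "us @ vs" "reflections n"] us vs
    by (simp add: word_prod_append)
qed

lemma abs_less_len: "abs_less n u w \<Longrightarrow> refl_len n u < refl_len n w"
proof -
  assume a: "abs_less n u w"
  have "refl_len n (inv u \<circ> w) \<noteq> 0"
  proof
    assume "refl_len n (inv u \<circ> w) = 0"
    then have "inv u \<circ> w = id"
      using a refl_len_eq_0 Sym_comp Sym_inv unfolding abs_less_def by blast
    then have "u = w" using Sym_cancel[of u n w] a unfolding abs_less_def by simp
    then show False using a unfolding abs_less_def by simp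
  qed
  then show ?thesis using a unfolding abs_less_def by simp
qed

lemma abs_less_id: "w \<in> Sym n \<Longrightarrow> w \<noteq> id \<Longrightarrow> abs_less n id w"
  unfolding abs_less_def using refl_len_id[of n] by (auto simp: Sym_id)

text \<open>
  Subadditivity of the length supplies the inequality in the definition of the absolute order
  that is not assumed here.
\<close>

lemma abs_lessI:
  assumes "u \<in> Sym n" "x \<in> Sym n" "refl_len n u + k \<le> refl_len n (u \<circ> x)"
    "refl_len n x \<le> k" "0 < k"
  shows "abs_less n u (u \<circ> x)"
proof -
  have "refl_len n (u \<circ> x) \<le> refl_len n u + refl_len n x" using refl_len_comp assms by blast
  moreover have "u \<noteq> u \<circ> x" using assms by (metis add_le_same_cancel1 not_le)
  ultimately show ?thesis
    unfolding abs_less_def using assms Sym_comp Sym_cancel'[of u n x] by auto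
qed

lemma abs_less_trans:
  assumes "abs_less n u v" "abs_less n v w"
  shows "abs_less n u w"
proof -
  have S: "u \<in> Sym n" "v \<in> Sym n" "w \<in> Sym n" using assms unfolding abs_less_def by auto
  let ?x = "inv u \<circ> v" let ?y = "inv v \<circ> w"
  have xy: "?x \<in> Sym n" "?y \<in> Sym n" using S Sym_comp Sym_inv by auto
  have eq: "u \<circ> (?x \<circ> ?y) = w"
    using Sym_cancel[OF S(1), of v] Sym_cancel[OF S(2), of w] by (simp only: comp_assoc[symmetric])
  have "refl_len n w = refl_len n u + (refl_len n ?x + refl_len n ?y)"
    using assms unfolding abs_less_def by simp
  moreover have "refl_len n (?x \<circ> ?y) \<le> refl_len n ?x + refl_len n ?y"
    using refl_len_comp xy by blast
  moreover have "refl_len n u < refl_len n w" using abs_less_len assms by (meson order.strict_trans)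
  ultimately have "abs_less n u (u \<circ> (?x \<circ> ?y))"
    by (intro abs_lessI[where k = "refl_len n ?x + refl_len n ?y"])
      (use S xy Sym_comp eq in auto)
  then show ?thesis using eq by simp
qed

text \<open>
  The first letter of a reduced word for \<open>inv u \<circ> w\<close> leads from \<open>u\<close> to an element strictly
  between \<open>u\<close> and \<open>w\<close>. So a maximal chain cannot skip a length.
\<close>

lemma abs_less_between:
  assumes "abs_less n u w" "refl_len n u + 1 < refl_len n w"
  obtains v where "abs_less n u v" "abs_less n v w"
proof -
  have S: "u \<in> Sym n" "w \<in> Sym n" using assms unfolding abs_less_def by auto
  let ?x = "inv u \<circ> w"
  have x: "?x \<in> Sym n" using S Sym_comp Sym_inv by auto
  obtain us where us: "set us \<subseteq> reflections n" "length us = refl_len n ?x" "word_prod us = ?x"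
    using refl_word x by blast
  have len: "refl_len n w = refl_len n u + length us" using assms us unfolding abs_less_def by simp
  then obtain t ts where ts: "us = t # ts" "ts \<noteq> []" using assms(2)
    by (cases us; cases "tl us") auto
  have t: "t \<in> Sym n" "refl_len n t \<le> 1"
    using us ts reflections_subset_Sym refl_len_refl by auto
  have "inv t \<circ> ?x = word_prod ts" using us(3)[symmetric] ts Sym_cancel'[OF t(1)] by simp
  then have ts': "word_prod ts \<in> Sym n" using Sym_comp[OF Sym_inv[OF t(1)] x] by simp
  have tsl: "refl_len n (word_prod ts) \<le> length ts" using us ts by (intro word_len_le) auto
  have w: "(u \<circ> t) \<circ> word_prod ts = w" using us(3) ts Sym_cancel[OF S(1), of w]
    by (simp add: comp_assoc)
  have ut: "u \<circ> t \<in> Sym n" using S t Sym_comp by blast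
  have l1: "refl_len n (u \<circ> t) \<le> refl_len n u + 1" using refl_len_comp[OF S(1) t(1)] t(2) by simp
  have l2: "refl_len n w \<le> refl_len n (u \<circ> t) + length ts"
    using refl_len_comp[OF ut ts'] tsl w by simp
  have "abs_less n u (u \<circ> t)" using l1 l2 len ts t S by (intro abs_lessI[where k = 1]) auto
  moreover have "abs_less n (u \<circ> t) (u \<circ> t \<circ> word_prod ts)"
    using l1 l2 len ts t S ut ts' w tsl by (intro abs_lessI[where k = "length ts"]) auto
  ultimately show ?thesis using that w by simp
qed

section \<open>Maximal chains as sequences of reflection steps\<close>

text \<open>
  The predecessor \<open>u\<close> is written as a product with \<open>w\<close>, since chains are taken apart from the
  top; a reflection being an involution, this says the same as \<open>w = u \<circ> t\<close>.
\<close>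

definition refl_step :: "nat \<Rightarrow> (nat \<Rightarrow> nat) \<Rightarrow> (nat \<Rightarrow> nat) \<Rightarrow> bool" where
  "refl_step n u w \<longleftrightarrow>
     w \<in> Sym n \<and> (\<exists>t\<in>reflections n. u = w \<circ> t) \<and> refl_len n w = Suc (refl_len n u)"

definition refl_chains :: "nat \<Rightarrow> (nat \<Rightarrow> nat) \<Rightarrow> (nat \<Rightarrow> nat) list set" where
  "refl_chains n w = {ws. ws \<noteq> [] \<and> hd ws = id \<and> last ws = w \<and> successively (refl_step n) ws}"

lemma reflection_involution: "t \<in> reflections n \<Longrightarrow> t \<circ> t = id"
  unfolding reflections_def by auto

lemma refl_step_abs_less:
  assumes "refl_step n u w"
  shows "abs_less n u w"
proof -
  obtain t where t: "w \<in> Sym n" "t \<in> reflections n" "u = w \<circ> t"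
    "refl_len n w = Suc (refl_len n u)"
    using assms unfolding refl_step_def by blast
  have tS: "t \<in> Sym n" using t reflections_subset_Sym by blast
  then have u: "u \<in> Sym n" using t Sym_comp by blast
  have "w = u \<circ> t" using t reflection_involution by (simp add: comp_assoc)
  moreover from this have "abs_less n u (u \<circ> t)"
    using t tS u refl_len_refl by (intro abs_lessI[where k = 1]) auto
  ultimately show ?thesis by simp
qed

lemma abs_less_refl_step:
  assumes "abs_less n u w" "refl_len n w = Suc (refl_len n u)"
  shows "refl_step n u w"
proof -
  have S: "u \<in> Sym n" "w \<in> Sym n" using assms unfolding abs_less_def by auto
  have "refl_len n (inv u \<circ> w) = 1" using assms unfolding abs_less_def by simp
  moreover obtain us where us: "set us \<subseteq> reflections n"
    "length us = refl_len n (inv u \<circ> w)" "word_prod us = inv u \<circ> w"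
    using refl_word Sym_comp[OF Sym_inv[OF S(1)] S(2)] by blast
  ultimately obtain t where t: "t \<in> reflections n" "inv u \<circ> w = t"
    by (cases us) auto
  then have "w \<circ> t = u \<circ> (t \<circ> t)" using Sym_cancel[OF S(1), of w] by (simp add: comp_assoc[symmetric])
  then have "u = w \<circ> t" using reflection_involution[OF t(1)] by simp
  then show ?thesis using S t assms unfolding refl_step_def by blast
qed

lemma abs_le_len: "abs_le n u w \<Longrightarrow> refl_len n u \<le> refl_len n w"
  unfolding abs_le_def using abs_less_len by fastforce

lemma transp_abs_less: "transp (abs_less n)"
  by (auto intro: transpI abs_less_trans)

lemma NC_I: "w \<in> Sym n \<Longrightarrow> abs_le n w c \<Longrightarrow> w \<in> NC n c"
  unfolding NC_def abs_le_def using abs_less_id by auto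

lemma refl_chains_nth_len:
  assumes "ws \<in> refl_chains n c" "i < length ws"
  shows "refl_len n (ws ! i) = i"
  using assms(2)
proof (induction i)
  case 0
  then have "ws ! 0 = id" using assms(1) unfolding refl_chains_def by (simp add: hd_conv_nth)
  then show ?case by (simp only: refl_len_id)
next
  case (Suc i)
  then have "refl_step n (ws ! i) (ws ! Suc i)"
    using assms(1) successively_nth unfolding refl_chains_def by blast
  then show ?case using Suc unfolding refl_step_def by simp
qed

lemma refl_chains_sorted:
  assumes "ws \<in> refl_chains n c"
  shows "sorted_wrt (abs_less n) ws"
proof -
  have "successively (abs_less n) ws"
    using assms refl_step_abs_less successively_mono unfolding refl_chains_def by blast
  then show ?thesis using successively_conv_sorted_wrt[OF transp_abs_less] by blast
qed

lemma refl_chains_length: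
  assumes "ws \<in> refl_chains n c"
  shows "length ws = Suc (refl_len n c)"
proof -
  have "ws \<noteq> []" "last ws = c" using assms unfolding refl_chains_def by auto
  then have "c = ws ! (length ws - 1)" "length ws - 1 < length ws" by (auto simp: last_conv_nth)
  then show ?thesis using refl_chains_nth_len[OF assms, of "length ws - 1"] by auto
qed

lemma refl_chains_NC:
  assumes c: "c \<in> Sym n" and ws: "ws \<in> refl_chains n c"
  shows "set ws \<subseteq> NC n c"
proof
  fix x assume "x \<in> set ws"
  then obtain i where i: "i < length ws" "x = ws ! i" by (metis in_set_conv_nth)
  have last: "c = ws ! (length ws - 1)" using ws unfolding refl_chains_def by (auto simp: last_conv_nth)
  have "abs_le n x c"
  proof (cases "i = length ws - 1")
    case True
    then show ?thesis using i last unfolding abs_le_def by simp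
  next
    case False
    then have "abs_less n (ws ! i) (ws ! (length ws - 1))"
      using i by (intro sorted_wrt_nth_less[OF refl_chains_sorted[OF ws]]) auto
    then show ?thesis using i last unfolding abs_le_def by simp
  qed
  moreover from this have "x \<in> Sym n" using c unfolding abs_le_def abs_less_def by auto
  ultimately show "x \<in> NC n c" by (rule NC_I[rotated])
qed

lemma sorted_comparable:
  assumes "sorted_wrt P ws" "x \<in> set ws" "y \<in> set ws"
  shows "x = y \<or> P x y \<or> P y x"
proof -
  obtain i j where "i < length ws" "x = ws ! i" "j < length ws" "y = ws ! j"
    using assms by (metis in_set_conv_nth)
  then show ?thesis using assms(1)
    by (cases i j rule: linorder_cases) (auto simp: sorted_wrt_iff_nth_less)
qed

text \<open>
  Inclusion-maximality is the same as containing every element that is comparable to the whole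
  chain.
\<close>

lemma maxchain_iff:
  "pred_on.maxchain A P C \<longleftrightarrow>
     pred_on.chain A P C \<and>
     (\<forall>x\<in>A. (\<forall>y\<in>C. x = y \<or> P x y \<or> P y x) \<longrightarrow> x \<in> C)" (is "?L \<longleftrightarrow> ?R")
proof
  assume L: ?L
  show ?R
  proof (intro conjI ballI impI)
    show "pred_on.chain A P C" using L by (simp add: pred_on.maxchain_def)
    fix x assume x: "x \<in> A" "\<forall>y\<in>C. x = y \<or> P x y \<or> P y x"
    then have "pred_on.chain A P (insert x C)"
      using L unfolding pred_on.maxchain_def pred_on.chain_def by auto
    then show "x \<in> C" using L unfolding pred_on.maxchain_def by blast
  qed
next
  assume R: ?R
  have False if chain: "pred_on.chain A P S" and sub: "C \<subset> S" for S
  proof -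
    obtain x where x: "x \<in> S" "x \<notin> C" using sub by blast
    have S: "S \<subseteq> A" "\<And>y z. y \<in> S \<Longrightarrow> z \<in> S \<Longrightarrow> y = z \<or> P y z \<or> P z y"
      using chain unfolding pred_on.chain_def by auto
    have "\<forall>y\<in>C. x = y \<or> P x y \<or> P y x" using S(2)[OF x(1)] sub by blast
    then show False using R x S(1) by blast
  qed
  then show ?L using R unfolding pred_on.maxchain_def by blast
qed

text \<open>
  The identity and \<open>c\<close> are comparable to everything in the interval, so they belong to each
  maximal chain, and consecutive members differ by one in length by \<open>abs_less_between\<close>.
  Conversely, a sequence of reflection steps has a member of each length up to that of \<open>c\<close>, and
  distinct elements of the same length are incomparable, so nothing can be inserted.
\<close>

theorem maximal_chains_eq_refl_chains:
  assumes c: "c \<in> Sym n"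
  shows "maximal_chains n c = refl_chains n c"
proof (intro equalityI subsetI)
  fix ws assume ws: "ws \<in> refl_chains n c"
  have sorted: "sorted_wrt (abs_less n) ws" using refl_chains_sorted ws .
  have "pred_on.chain (NC n c) (abs_less n) (set ws)"
    using refl_chains_NC[OF c ws] sorted_comparable[OF sorted] unfolding pred_on.chain_def by blast
  moreover have "x \<in> set ws"
    if x: "x \<in> NC n c" and comp: "\<forall>y\<in>set ws. x = y \<or> abs_less n x y \<or> abs_less n y x" for x
  proof -
    let ?y = "ws ! refl_len n x"
    have "abs_le n x c" using x unfolding NC_def by blast
    then have "refl_len n x < length ws" using abs_le_len refl_chains_length[OF ws] by fastforce
    then have "refl_len n ?y = refl_len n x" "?y \<in> set ws" using refl_chains_nth_len[OF ws] by auto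
    then show ?thesis using comp abs_less_len by (metis nat_neq_iff)
  qed
  ultimately show "ws \<in> maximal_chains n c"
    using sorted unfolding maximal_chains_def maxchain_iff by blast
next
  fix ws assume "ws \<in> maximal_chains n c"
  then have sorted: "sorted_wrt (abs_less n) ws"
    and sub: "set ws \<subseteq> NC n c"
    and mx: "\<And>x. x \<in> NC n c \<Longrightarrow> \<forall>y\<in>set ws. x = y \<or> abs_less n x y \<or> abs_less n y x \<Longrightarrow> x \<in> set ws"
    unfolding maximal_chains_def maxchain_iff pred_on.chain_def by blast+
  have nth: "abs_less n (ws ! i) (ws ! j)" if "i < j" "j < length ws" for i j
    using sorted_wrt_nth_less[OF sorted that] .
  have "id \<in> set ws"
  proof (rule mx)
    show "id \<in> NC n c" using NC_I Sym_id c abs_less_id unfolding abs_le_def by blast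
    show "\<forall>y\<in>set ws. id = y \<or> abs_less n id y \<or> abs_less n y id"
      using sub abs_less_id unfolding NC_def by blast
  qed
  then obtain k where k: "k < length ws" "ws ! k = id" by (metis in_set_conv_nth)
  have "k = 0"
  proof (rule ccontr)
    assume "k \<noteq> 0"
    then have "abs_less n (ws ! 0) id" using nth[of 0 k] k by simp
    then show False using abs_less_len refl_len_id by fastforce
  qed
  then have hd: "ws \<noteq> []" "hd ws = id" using k by (auto simp: hd_conv_nth)
  have "c \<in> set ws"
  proof (rule mx)
    show "c \<in> NC n c" using NC_I c unfolding abs_le_def by blast
    show "\<forall>y\<in>set ws. c = y \<or> abs_less n c y \<or> abs_less n y c"
      using sub unfolding NC_def abs_le_def by blast
  qed
  then obtain l where l: "l < length ws" "ws ! l = c" by (metis in_set_conv_nth)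
  have "l = length ws - 1"
  proof (rule ccontr)
    assume "l \<noteq> length ws - 1"
    then have "abs_less n c (ws ! (length ws - 1))" using nth[of l "length ws - 1"] l by simp
    moreover have "ws ! (length ws - 1) \<in> NC n c" using sub hd by (meson length_greater_0_conv diff_less nth_mem zero_less_one subsetD)
    then have "abs_le n (ws ! (length ws - 1)) c" unfolding NC_def by blast
    ultimately show False using abs_less_len abs_le_len by fastforce
  qed
  then have last: "last ws = c" using l hd by (simp add: last_conv_nth)
  have step: "refl_step n (ws ! i) (ws ! Suc i)" if i: "Suc i < length ws" for i
  proof (rule abs_less_refl_step)
    let ?u = "ws ! i" let ?w = "ws ! Suc i"
    show uw: "abs_less n ?u ?w" using nth i by simp
    show "refl_len n ?w = Suc (refl_len n ?u)"
    proof (rule ccontr)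
      assume "\<not> ?thesis"
      then have "refl_len n ?u + 1 < refl_len n ?w" using abs_less_len[OF uw] by simp
      then obtain v where v: "abs_less n ?u v" "abs_less n v ?w" using abs_less_between uw by blast
      have below: "abs_less n (ws ! j) v" if "j \<le> i" for j
        using nth[of j i] i v(1) abs_less_trans that by (cases "j = i") auto
      have above: "abs_less n v (ws ! j)" if "Suc i \<le> j" "j < length ws" for j
        using nth[of "Suc i" j] v(2) abs_less_trans that by (cases "j = Suc i") auto
      have "v \<in> set ws"
      proof (rule mx)
        have "abs_less n v c" using above[of l] \<open>l = _\<close> l i by simp
        then show "v \<in> NC n c" using NC_I unfolding abs_le_def abs_less_def by blast
        show "\<forall>y\<in>set ws. v = y \<or> abs_less n v y \<or> abs_less n y v"
          using below above by (metis in_set_conv_nth not_less_eq_eq)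
      qed
      then obtain j where "j < length ws" "ws ! j = v" by (metis in_set_conv_nth)
      then show False using below[of j] above[of j] abs_less_len by (metis less_irrefl not_less_eq_eq)
    qed
  qed
  show "ws \<in> refl_chains n c"
    unfolding refl_chains_def successively_conv_nth using hd last step by blast
qed

lemma refl_chains_edge:
  assumes c: "c \<in> Sym n" and ws: "ws \<in> refl_chains n c" and i: "Suc i < length ws"
  shows "edge n c (ws ! i) (ws ! Suc i)"
proof -
  have "refl_step n (ws ! i) (ws ! Suc i)"
    using ws i successively_nth unfolding refl_chains_def by blast
  then have "abs_covers n (ws ! Suc i) (ws ! i)"
    unfolding abs_covers_def using refl_step_abs_less abs_less_len unfolding refl_step_def
    by (metis Suc_leI not_le)
  moreover have "ws ! i \<in> NC n c" "ws ! Suc i \<in> NC n c"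
    using refl_chains_NC[OF c ws] i nth_mem by (auto intro: Suc_lessD)
  ultimately show ?thesis unfolding edge_def by blast
qed

section \<open>Runs of occupied spaces and permutations with increasing cycles\<close>

text \<open>
  The first free space from \<open>z\<close> on; the spaces of a maximal run and the free space behind it are
  exactly the numbers sharing this value.
\<close>

definition run_end :: "nat set \<Rightarrow> nat \<Rightarrow> nat" where
  "run_end occ z = (LEAST q. z \<le> q \<and> q \<notin> occ)"

text \<open>
  The permutation whose cycles are the maximal runs of \<open>occ\<close>, each together with the free space
  that follows it. It moves up by one along the run and returns from the free space to the start
  of the run. A free space preceded by a free space, that is, with an empty run, is a fixed
  point.
\<close>

definition run_cycles :: "nat set \<Rightarrow> nat \<Rightarrow> nat" where
  "run_cycles occ z = (if z \<in> occ then Suc z else (LEAST x. {x..<z} \<subseteq> occ))"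

lemma run_end:
  assumes "finite occ"
  shows "z \<le> run_end occ z" "run_end occ z \<notin> occ" "{z..<run_end occ z} \<subseteq> occ"
proof -
  obtain q where "\<forall>x\<in>occ. x < q" using assms finite_nat_set_iff_bounded by blast
  then have "z \<le> max z q \<and> max z q \<notin> occ" by auto
  from LeastI[where P = "\<lambda>q. z \<le> q \<and> q \<notin> occ", OF this]
  show "z \<le> run_end occ z" "run_end occ z \<notin> occ" by (auto simp: run_end_def)
  show "{z..<run_end occ z} \<subseteq> occ"
  proof
    fix x assume "x \<in> {z..<run_end occ z}"
    then show "x \<in> occ"
      using not_less_Least[where P = "\<lambda>q. z \<le> q \<and> q \<notin> occ" and k = x] by (simp add: run_end_def)
  qed
qed

lemma run_end_eqI:
  assumes "z \<le> q" "q \<notin> occ" "{z..<q} \<subseteq> occ"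
  shows "run_end occ z = q"
  unfolding run_end_def
proof (rule Least_equality)
  show "q \<le> y" if "z \<le> y \<and> y \<notin> occ" for y using that assms by (metis atLeastLessThan_iff not_le subsetD)
qed (use assms in simp)

lemma run_end_eq_iff:
  assumes "finite occ" "i \<le> j"
  shows "run_end occ i = run_end occ j \<longleftrightarrow> {i..<j} \<subseteq> occ"
proof
  assume "run_end occ i = run_end occ j"
  then have "{i..<j} \<subseteq> {i..<run_end occ i}" using run_end(1)[OF assms(1), of j] by auto
  then show "{i..<j} \<subseteq> occ" using run_end(3)[OF assms(1), of i] by blast
next
  assume ij: "{i..<j} \<subseteq> occ"
  have "{i..<run_end occ j} \<subseteq> {i..<j} \<union> {j..<run_end occ j}" by auto
  then show "run_end occ i = run_end occ j"
    using run_end[OF assms(1), of j] ij assms(2) by (intro run_end_eqI) auto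
qed

lemma run_cycles_in: "z \<in> occ \<Longrightarrow> run_cycles occ z = Suc z"
  by (simp add: run_cycles_def)

lemma run_cycles_eqI:
  assumes "z \<notin> occ" "x \<le> z" "{x..<z} \<subseteq> occ" "x = 0 \<or> x - 1 \<notin> occ"
  shows "run_cycles occ z = x"
proof -
  have "(LEAST x. {x..<z} \<subseteq> occ) = x"
  proof (rule Least_equality)
    show "x \<le> y" if "{y..<z} \<subseteq> occ" for y
    proof (rule ccontr)
      assume "\<not> x \<le> y"
      then have "x - 1 \<in> {y..<z}" "x \<noteq> 0" using assms(2) by auto
      then show False using assms(4) that by blast
    qed
  qed (rule assms)
  then show ?thesis using assms(1) by (simp add: run_cycles_def)
qed

lemma run_cycles_out:
  assumes "z \<notin> occ"
  shows "run_cycles occ z \<le> z" "{run_cycles occ z..<z} \<subseteq> occ"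
    "run_cycles occ z = 0 \<or> run_cycles occ z - 1 \<notin> occ"
proof -
  let ?x = "LEAST x. {x..<z} \<subseteq> occ"
  have eq: "run_cycles occ z = ?x" using assms by (simp add: run_cycles_def)
  have triv: "{z..<z} \<subseteq> occ" by simp
  show 1: "{run_cycles occ z..<z} \<subseteq> occ"
    unfolding eq by (rule LeastI[where P = "\<lambda>x. {x..<z} \<subseteq> occ", OF triv])
  show 2: "run_cycles occ z \<le> z"
    unfolding eq by (rule Least_le[where P = "\<lambda>x. {x..<z} \<subseteq> occ", OF triv])
  show "run_cycles occ z = 0 \<or> run_cycles occ z - 1 \<notin> occ"
  proof (rule ccontr)
    assume a: "\<not> ?thesis"
    have "{?x - 1..<z} \<subseteq> {?x..<z} \<union> {?x - 1}" by auto
    then have "{?x - 1..<z} \<subseteq> occ" using 1 a eq by auto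
    then have "?x \<le> ?x - 1" by (rule Least_le)
    moreover have "?x \<noteq> 0" using a eq by simp
    ultimately show False by linarith
  qed
qed

lemma cycle_of_list_run_cycles:
  "cycle_of_list [a..<a + Suc k] = run_cycles {a..<a + k}"
proof (induction k arbitrary: a)
  case 0
  have "run_cycles {} z = z" for z by (rule run_cycles_eqI) auto
  then show ?case by (simp add: fun_eq_iff)
next
  case (Suc k)
  have "[a..<a + Suc (Suc k)] = a # Suc a # [Suc (Suc a)..<Suc a + Suc k]"
    "[Suc a..<Suc a + Suc k] = Suc a # [Suc (Suc a)..<Suc a + Suc k]"
    by (simp_all add: upt_rec)
  then have eq: "cycle_of_list [a..<a + Suc (Suc k)] =
      transpose a (Suc a) \<circ> run_cycles {Suc a..<Suc a + k}"
    using Suc[of "Suc a"] by (simp only: cycle_of_list.simps)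
  have "transpose a (Suc a) (run_cycles {Suc a..<Suc a + k} z) = run_cycles {a..<a + Suc k} z" for z
  proof -
    consider "z \<in> {Suc a..<Suc a + k}" | "z = a" | "z = Suc a + k" | "z < a \<or> z > Suc a + k"
      by fastforce
    then show ?thesis
    proof cases
      case 1
      then show ?thesis by (simp add: run_cycles_in transpose_def)
    next
      case 2
      then have "run_cycles {Suc a..<Suc a + k} z = a" by (intro run_cycles_eqI) auto
      then show ?thesis using 2 by (simp add: run_cycles_in)
    next
      case 3
      then have "run_cycles {Suc a..<Suc a + k} z = Suc a" "run_cycles {a..<a + Suc k} z = a"
        by (auto intro!: run_cycles_eqI)
      then show ?thesis by simp
    next
      case 4
      then have "run_cycles {Suc a..<Suc a + k} z = z" "run_cycles {a..<a + Suc k} z = z"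
        by (auto intro!: run_cycles_eqI)
      then show ?thesis using 4 by (auto simp: transpose_def)
    qed
  qed
  then show ?case unfolding eq by (simp add: fun_eq_iff)
qed

lemma long_cycle_run_cycles: "long_cycle n = run_cycles {1..n}"
proof -
  have "{1..<1 + n} = {1..n}" by auto
  then show ?thesis using cycle_of_list_run_cycles[of 1 n] unfolding long_cycle_def by simp
qed

text \<open>
  This relates a set of occupied spaces to a permutation \<open>w\<close> by conjugation: \<open>\<beta>\<close> carries every
  run with its following free space onto a cycle of \<open>w\<close>, in increasing order. Hence the cycles
  of \<open>w\<close>, like those of a noncrossing permutation, go up through a block and return from its
  maximum to its minimum, and a block has one element more than the corresponding run.
\<close>

definition run_labelling :: "nat \<Rightarrow> nat set \<Rightarrow> (nat \<Rightarrow> nat) \<Rightarrow> (nat \<Rightarrow> nat) \<Rightarrow> bool" where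
  "run_labelling n occ \<beta> w \<longleftrightarrow> occ \<subseteq> {1..n} \<and> w \<in> Sym n \<and> \<beta> \<in> Sym n \<and>
     \<beta> \<circ> run_cycles occ = w \<circ> \<beta> \<and> (\<forall>z\<in>occ. \<beta> z < \<beta> (Suc z))"

lemma run_labellingD:
  assumes "run_labelling n occ \<beta> w"
  shows "occ \<subseteq> {1..n}" "w \<in> Sym n" "\<beta> \<in> Sym n" "\<beta> permutes {1..n + 1}"
  using assms by (simp_all add: run_labelling_def Sym_def)

lemma run_labelling_finite: "run_labelling n occ \<beta> w \<Longrightarrow> finite occ"
  unfolding run_labelling_def by (auto intro: finite_subset)

lemma run_labelling_apply: "run_labelling n occ \<beta> w \<Longrightarrow> w (\<beta> z) = \<beta> (run_cycles occ z)"
  unfolding run_labelling_def by (metis comp_apply)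

lemma run_labelling_mono:
  assumes "run_labelling n occ \<beta> w" "i < j" "{i..<j} \<subseteq> occ"
  shows "\<beta> i < \<beta> j"
  using assms(2,3)
proof (induction j)
  case (Suc j)
  have "j \<in> occ" using Suc.prems by auto
  then have "\<beta> j < \<beta> (Suc j)" using assms(1) unfolding run_labelling_def by blast
  moreover have "i = j \<or> \<beta> i < \<beta> j" using Suc by fastforce
  ultimately show ?case by auto
qed simp

lemma run_labelling_empty:
  assumes "run_labelling n {} \<beta> w"
  shows "w = id"
proof
  fix y
  have "surj \<beta>" using assms unfolding run_labelling_def Sym_def using permutes_surj by blast
  then obtain z where z: "y = \<beta> z" by blast
  have "run_cycles {} z = z" by (rule run_cycles_eqI) auto
  then show "w y = id y" using run_labelling_apply[OF assms, of z] z by simp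
qed

lemma run_labelling_long_cycle: "run_labelling n {1..n} id (long_cycle n)"
proof -
  have "cycle_of_list [1..<n + 2] permutes set [1..<n + 2]" by (rule cycle_permutes)
  moreover have "set [1..<n + 2] = {1..n + 1}" by auto
  ultimately have "long_cycle n \<in> Sym n" unfolding long_cycle_def Sym_def by simp
  then show ?thesis unfolding run_labelling_def using long_cycle_run_cycles Sym_id by simp
qed

text \<open>
  The permutation interchanging the adjacent segments \<open>{i<..p}\<close> and \<open>{p<..e}\<close>, keeping the order
  inside each; here \<open>j - i = e - p\<close> is the length of the second segment.
\<close>

definition swap_segments :: "nat \<Rightarrow> nat \<Rightarrow> nat \<Rightarrow> nat \<Rightarrow> nat \<Rightarrow> nat" where
  "swap_segments i j p e z = (if i < z \<and> z \<le> p then z + (j - i) else if p < z \<and> z \<le> e then z - (p - i) else z)"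

lemma swap_segments_Sym:
  assumes "p + j = i + e" "i < j" "j \<le> e" "1 \<le> i" "e \<le> n + 1"
  shows "swap_segments i j p e \<in> Sym n"
proof -
  have "inj_on (swap_segments i j p e) {1..n + 1}"
    using assms unfolding inj_on_def swap_segments_def by auto
  moreover have "swap_segments i j p e ` {1..n + 1} \<subseteq> {1..n + 1}"
    using assms unfolding swap_segments_def by auto
  ultimately have "bij_betw (swap_segments i j p e) {1..n + 1} {1..n + 1}"
    by (simp add: endo_inj_surj bij_betw_def)
  then show ?thesis unfolding Sym_def using assms
    by (auto intro!: bij_imp_permutes simp: swap_segments_def)
qed

text \<open>
  Let \<open>x\<close> be the first element of the run of \<open>i\<close> and \<open>e\<close> the free space behind it. Multiplying
  the cycle on \<open>{x..e}\<close> by \<open>(i j)\<close> cuts it into cycles on \<open>{i<..j}\<close> and on \<open>{x..i} \<union> {j<..e}\<close>,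
  while freeing the space \<open>p\<close> cuts it into cycles on \<open>{x..p}\<close> and \<open>{p<..e}\<close>. The choice \<open>p = i +
  e - j\<close> makes the sizes agree, and the interchange of segments conjugates the second pair of
  cycles to the first.
\<close>

lemma swap_segments_conj:
  assumes fin: "finite occ" and "0 \<notin> occ" and ij: "i < j" "{i..<j} \<subseteq> occ"
    and e: "e = run_end occ i" and p: "p + j = i + e"
  shows "swap_segments i j p e (run_cycles (occ - {p}) z) = run_cycles occ (transpose i j (swap_segments i j p e z))"
proof -
  have e1: "e \<notin> occ" "{i..<e} \<subseteq> occ" using run_end[OF fin, of i] e by auto
  have ie: "i \<le> e" using run_end[OF fin, of i] e by auto
  have je: "j \<le> e"
  proof (rule ccontr)
    assume "\<not> j \<le> e"
    then have "e \<in> {i..<j}" using ie by simp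
    then show False using ij(2) e1(1) by blast
  qed
  have pe: "i \<le> p" "p < e" using p ij je by auto
  have pocc: "p \<in> occ" using e1 pe by auto
  let ?x = "run_cycles occ e"
  have x: "?x \<le> e" "{?x..<e} \<subseteq> occ" "?x = 0 \<or> ?x - 1 \<notin> occ" using run_cycles_out e1(1) by auto
  have xi: "?x \<le> i"
  proof (rule ccontr)
    assume "\<not> ?x \<le> i"
    then have x': "?x - 1 \<in> {i..<e}" "?x \<noteq> 0" using x(1) by auto
    show False using x(3) x'(2) subsetD[OF e1(2) x'(1)] by simp
  qed
  consider "z = p" | "z = e" | "i \<le> z" "z < p" | "p < z" "z < e" | "z < i \<or> e < z" "z \<in> occ"
    | "z < i \<or> e < z" "z \<notin> occ" by linarith
  then show ?thesis
  proof cases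
    case 1
    have "run_cycles (occ - {p}) p = ?x" using x xi pe by (intro run_cycles_eqI) auto
    moreover have "transpose i j (swap_segments i j p e p) = e"
      using p ij je pe by (auto simp: swap_segments_def transpose_def)
    ultimately show ?thesis using 1 xi pe by (simp add: swap_segments_def)
  next
    case 2
    have "run_cycles (occ - {p}) e = Suc p" using e1 pe by (intro run_cycles_eqI) auto
    moreover have "transpose i j (swap_segments i j p e e) = i"
      using p ij je pe by (auto simp: swap_segments_def transpose_def)
    moreover have "i \<in> occ" using e1 pe by auto
    ultimately show ?thesis using 2 e1 pe by (auto simp: swap_segments_def run_cycles_in)
  next
    case 3
    then have "z \<in> occ - {p}" using e1 pe by auto
    moreover have "transpose i j (swap_segments i j p e z) = z + (j - i)"
      using p ij je pe 3 by (auto simp: swap_segments_def transpose_def)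
    moreover have "z + (j - i) \<in> {i..<e}" using p ij 3 by auto
    then have "z + (j - i) \<in> occ" using e1(2) by blast
    ultimately show ?thesis using 3 by (simp add: run_cycles_in swap_segments_def)
  next
    case 4
    then have "z \<in> occ - {p}" using e1 pe by auto
    moreover have "transpose i j (swap_segments i j p e z) = z - (p - i)"
      using p ij je pe 4 by (auto simp: swap_segments_def transpose_def)
    moreover have "z - (p - i) \<in> {i..<e}" using p ij je 4 by auto
    then have "z - (p - i) \<in> occ" using e1(2) by blast
    ultimately show ?thesis using 4 pe by (simp add: run_cycles_in swap_segments_def)
  next
    case 5
    then have "z \<in> occ - {p}" using pe by auto
    moreover have "transpose i j (swap_segments i j p e z) = z"
      using p ij je pe 5 by (auto simp: swap_segments_def transpose_def)
    ultimately show ?thesis using 5 pe by (auto simp: run_cycles_in swap_segments_def)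
  next
    case 6
    \<comment> \<open>another free space; \<open>?y\<close> is where the run in front of it starts\<close>
    let ?y = "run_cycles occ z"
    have y: "?y \<le> z" "{?y..<z} \<subseteq> occ" "?y = 0 \<or> ?y - 1 \<notin> occ" using run_cycles_out 6 by auto
    have yo: "z < i \<or> e < ?y"
    proof (rule ccontr)
      assume a: "\<not> ?thesis"
      then have "e \<in> {?y..<z}" using 6 by auto
      then show False using y(2) e1 by blast
    qed
    then have "p \<notin> {?y..<z}" using pe by auto
    then have "run_cycles (occ - {p}) z = ?y" using y 6 by (intro run_cycles_eqI) auto
    moreover have "transpose i j (swap_segments i j p e z) = z"
      using p ij je pe 6 by (auto simp: swap_segments_def transpose_def)
    moreover have "swap_segments i j p e ?y = ?y" using yo y(1) pe by (auto simp: swap_segments_def)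
    ultimately show ?thesis by simp
  qed
qed

text \<open>
  One step backwards on both sides at once: freeing a space and splitting a cycle preserve the
  correspondence.
\<close>

lemma run_labelling_descend:
  assumes m: "run_labelling n occ \<beta> w" and ij: "i < j" "{i..<j} \<subseteq> occ"
    and e: "e = run_end occ i" and p: "p + j = i + e"
  shows "run_labelling n (occ - {p}) (\<beta> \<circ> swap_segments i j p e) (w \<circ> transpose (\<beta> i) (\<beta> j))"
proof -
  let ?s = "swap_segments i j p e" and ?t = "transpose (\<beta> i) (\<beta> j)"
  have fin: "finite occ" using run_labelling_finite m .
  have sub: "occ \<subseteq> {1..n}" and \<beta>: "\<beta> \<in> Sym n" and w: "w \<in> Sym n" using m unfolding run_labelling_def by auto
  have zero: "0 \<notin> occ" using sub by auto
  have e1: "i \<le> e" "e \<notin> occ" "{i..<e} \<subseteq> occ" using run_end[OF fin, of i] e by auto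
  have je: "j \<le> e"
  proof (rule ccontr)
    assume "\<not> j \<le> e"
    then have "e \<in> {i..<j}" using e1(1) by simp
    then show False using ij(2) e1(2) by blast
  qed
  have iocc: "i \<in> occ" using ij by auto
  have "e - 1 \<in> occ" using e1 je ij by auto
  then have "e - 1 \<in> {1..n}" "i \<in> {1..n}" using sub iocc by blast+
  then have en: "e \<le> n + 1" "1 \<le> i" by auto
  have inj: "inj \<beta>" using \<beta> by (auto simp: Sym_def permutes_inj)
  have rotS: "?s \<in> Sym n" using swap_segments_Sym p ij je en by blast
  have range: "i \<in> {1..n+1}" "j \<in> {1..n+1}" using en ij je by auto
  have "\<beta> i \<in> {1..n+1}" "\<beta> j \<in> {1..n+1}" "\<beta> i \<noteq> \<beta> j"
    using \<beta> range ij inj permutes_in_image[of \<beta> "{1..n+1}"] unfolding Sym_def by (auto simp: inj_eq)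
  then have t: "?t \<in> Sym n" using reflectionI reflections_subset_Sym by blast
  have bt: "?t (\<beta> z) = \<beta> (transpose i j z)" for z
    using inj by (auto simp: transpose_def inj_eq)
  have "\<beta> (?s (run_cycles (occ - {p}) z)) = w (?t (\<beta> (?s z)))" for z
    using swap_segments_conj[OF fin zero ij e p, of z] run_labelling_apply[OF m] bt by simp
  then have "(\<beta> \<circ> ?s) \<circ> run_cycles (occ - {p}) = (w \<circ> ?t) \<circ> (\<beta> \<circ> ?s)"
    by (simp add: fun_eq_iff)
  moreover have "\<beta> (?s z) < \<beta> (?s (Suc z))" if z: "z \<in> occ - {p}" for z
  proof -
    have ze: "z \<noteq> e" using z e1 by auto
    have "{?s z..<?s (Suc z)} \<subseteq> occ" "?s z < ?s (Suc z)"
    proof -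
      consider "i < z" "z < p" | "p < z" "z < e" | "z < i \<or> e < z" | "z = i" "i < p" using z ze by fastforce
      then show "{?s z..<?s (Suc z)} \<subseteq> occ"
      proof cases
        case 1
        then have "?s z = z + (j - i)" "?s (Suc z) = Suc (z + (j - i))"
          by (simp_all add: swap_segments_def)
        moreover have "z + (j - i) \<in> {i..<e}" using 1 p ij by auto
        ultimately show ?thesis using e1(3) by auto
      next
        case 2
        then have "?s z = z - (p - i)" "?s (Suc z) = Suc (z - (p - i))"
          using p je by (auto simp: swap_segments_def)
        moreover have "z - (p - i) \<in> {i..<e}" using 2 p ij je by auto
        ultimately show ?thesis using e1(3) by auto
      next
        case 3
        then show ?thesis using z p ij je by (auto simp: swap_segments_def)
      next
        case 4
        then have "?s z = i" "?s (Suc z) = Suc i + (j - i)" by (auto simp: swap_segments_def)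
        moreover have "{i..<Suc i + (j - i)} \<subseteq> {i..<e}" using p 4 ij(1) by auto
        ultimately show ?thesis using e1(3) by auto
      qed
      show "?s z < ?s (Suc z)"
        using z ze p ij je by (auto simp: swap_segments_def)
    qed
    then show ?thesis using run_labelling_mono[OF m] by blast
  qed
  ultimately show ?thesis
    unfolding run_labelling_def using sub Sym_comp[OF w t] Sym_comp[OF \<beta> rotS] by auto
qed

section \<open>Reflection length and the steps below a permutation\<close>

text \<open>
  Each reflection in the word merges at most two colour classes, so a word of length \<open>k\<close> in the
  symmetric group on \<open>n + 1\<close> letters leaves a colouring with at least \<open>n + 1 - k\<close> colours that
  is invariant under every letter. This gives the lower bound for reflection lengths.
\<close>

lemma word_colouring:
  assumes "set us \<subseteq> reflections n"
  shows "\<exists>f :: nat \<Rightarrow> nat. (\<forall>t\<in>set us. \<forall>x. f (t x) = f x) \<and>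
    n + 1 \<le> card (f ` {1..n + 1}) + length us"
  using assms
proof (induction us)
  case Nil
  show ?case by (intro exI[of _ id]) auto
next
  case (Cons t us)
  then have "set us \<subseteq> reflections n" by simp
  from Cons.IH[OF this] obtain f :: "nat \<Rightarrow> nat" where f: "\<forall>t\<in>set us. \<forall>x. f (t x) = f x"
    "n + 1 \<le> card (f ` {1..n + 1}) + length us" by blast
  obtain a b where t: "t = transpose a b" using Cons.prems unfolding reflections_def by auto
  \<comment> \<open>merge the colours of the two points that \<open>t\<close> interchanges\<close>
  define g where "g x = (if f x = f b then f a else f x)" for x
  have "f ` {1..n + 1} \<subseteq> insert (f b) (g ` {1..n + 1})"
    unfolding g_def by auto
  then have "card (f ` {1..n + 1}) \<le> card (insert (f b) (g ` {1..n + 1}))"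
    by (intro card_mono) auto
  also have "\<dots> \<le> Suc (card (g ` {1..n + 1}))" by (rule card_insert_le_m1) auto
  finally have "n + 1 \<le> card (g ` {1..n + 1}) + length (t # us)" using f(2) by simp
  moreover have "\<forall>s\<in>set (t # us). \<forall>x. g (s x) = g x"
    using f(1) t by (auto simp: g_def transpose_def)
  ultimately show ?case by blast
qed

lemma invariant_word_prod:
  "\<forall>t\<in>set us. \<forall>x. f (t x) = f x \<Longrightarrow> f (word_prod us x) = f x"
  by (induction us) auto

lemma run_labelling_card_run_ends:
  assumes "run_labelling n occ \<beta> w"
  shows "card ({1..n + 1} - occ) + card occ = n + 1"
proof -
  have "occ \<subseteq> {1..n + 1}" using run_labellingD(1)[OF assms] by auto
  then show ?thesis using card_Diff_subset[of occ "{1..n + 1}"] run_labelling_finite[OF assms]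
      card_mono[of "{1..n + 1}" occ] by simp
qed

text \<open>
  A colouring invariant under all letters is invariant under \<open>w\<close>, hence constant on its cycles.
  Each cycle corresponds to exactly one free space, so the number of colours is at most the
  number of free spaces.
\<close>

lemma run_labelling_word:
  assumes m: "run_labelling n occ \<beta> w" and us: "set us \<subseteq> reflections n" "word_prod us = w"
  obtains f :: "nat \<Rightarrow> nat" where "\<And>t x. t \<in> set us \<Longrightarrow> f (t x) = f x"
    "\<And>z. f (\<beta> z) = f (\<beta> (run_end occ z))"
    "n + 1 \<le> card ((\<lambda>z. f (\<beta> z)) ` ({1..n + 1} - occ)) + length us"
proof -
  obtain f :: "nat \<Rightarrow> nat" where f: "\<forall>t\<in>set us. \<forall>x. f (t x) = f x"
    "n + 1 \<le> card (f ` {1..n + 1}) + length us"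
    using word_colouring us by blast
  have fin: "finite occ" using run_labelling_finite m .
  have invariant: "f (\<beta> (Suc z)) = f (\<beta> z)" if "z \<in> occ" for z
    using invariant_word_prod[OF f(1), of "\<beta> z"] run_labelling_apply[OF m, of z] us(2) that
    by (simp add: run_cycles_in)
  have up: "f (\<beta> q) = f (\<beta> z)" if "z \<le> q" "{z..<q} \<subseteq> occ" for z q
    using that
  proof (induction q rule: dec_induct)
    case (step q)
    then have "q \<in> occ" "{z..<q} \<subseteq> occ" by auto
    then show ?case using step.IH invariant by simp
  qed simp
  have ends: "f (\<beta> z) = f (\<beta> (run_end occ z))" for z using up run_end[OF fin] by metis
  have "\<beta> ` {1..n + 1} = {1..n + 1}" using permutes_image[OF run_labellingD(4)[OF m]] .
  then have "f ` {1..n + 1} = (\<lambda>z. f (\<beta> z)) ` {1..n + 1}" by (metis image_image)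
  also have "\<dots> \<subseteq> (\<lambda>z. f (\<beta> z)) ` ({1..n + 1} - occ)"
  proof
    fix y assume "y \<in> (\<lambda>z. f (\<beta> z)) ` {1..n + 1}"
    then obtain z where z: "z \<in> {1..n + 1}" "y = f (\<beta> z)" by blast
    have "n + 1 \<notin> occ" using run_labellingD(1)[OF m] by auto
    then have "run_end occ z \<le> n + 1" using z unfolding run_end_def by (intro Least_le) auto
    then have "run_end occ z \<in> {1..n + 1} - occ" using run_end[OF fin, of z] z by auto
    then show "y \<in> (\<lambda>z. f (\<beta> z)) ` ({1..n + 1} - occ)" using z ends by blast
  qed
  finally have "card (f ` {1..n + 1}) \<le> card ((\<lambda>z. f (\<beta> z)) ` ({1..n + 1} - occ))"
    by (intro card_mono) auto
  then show ?thesis using that[of f] f ends by auto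
qed

lemma run_labelling_word_length:
  assumes "run_labelling n occ \<beta> w" "set us \<subseteq> reflections n" "word_prod us = w"
  shows "card occ \<le> length us"
proof -
  obtain f :: "nat \<Rightarrow> nat" where
    "n + 1 \<le> card ((\<lambda>z. f (\<beta> z)) ` ({1..n + 1} - occ)) + length us"
    using run_labelling_word[OF assms] by metis
  then show ?thesis
    using card_image_le[of "{1..n + 1} - occ" "\<lambda>z. f (\<beta> z)"] run_labelling_card_run_ends[OF assms(1)]
    by simp
qed

text \<open>
  The common index set for the ways to undo the last car and for the elements covered by \<open>w\<close>:
  two positions of the same cycle of \<open>run_cycles occ\<close>. The larger one may be the free space
  behind the run.
\<close>

definition run_pairs :: "nat set \<Rightarrow> (nat \<times> nat) set" where
  "run_pairs occ = {(i, j). i < j \<and> {i..<j} \<subseteq> occ}"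

text \<open>
  The space whose release matches the splitting of a cycle by the reflection that belongs to
  \<open>(i, j)\<close>. Conversely, a last car with preference \<open>i\<close> that parks at \<open>p\<close> belongs to the pair
  with \<open>j = i + run_end occ i - p\<close>.
\<close>

definition split_at :: "nat set \<Rightarrow> nat \<Rightarrow> nat \<Rightarrow> nat" where
  "split_at occ i j = i + run_end occ i - j"

lemma run_pairsD:
  assumes "finite occ" "(i, j) \<in> run_pairs occ"
  shows "i < j" "{i..<j} \<subseteq> occ" "j \<le> run_end occ i" "i \<in> occ"
    "split_at occ i j + j = i + run_end occ i" "i \<le> split_at occ i j"
    "split_at occ i j < run_end occ i" "split_at occ i j \<in> occ"
proof -
  show ij: "i < j" "{i..<j} \<subseteq> occ" using assms unfolding run_pairs_def by auto
  note e = run_end[OF assms(1), of i]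
  show je: "j \<le> run_end occ i"
  proof (rule ccontr)
    assume "\<not> ?thesis"
    then have "run_end occ i \<in> {i..<j}" using e(1) by simp
    then show False using ij(2) e(2) by blast
  qed
  show "i \<in> occ" using ij by auto
  show p: "split_at occ i j + j = i + run_end occ i" "i \<le> split_at occ i j"
    "split_at occ i j < run_end occ i"
    using ij(1) je unfolding split_at_def by auto
  then have "split_at occ i j \<in> {i..<run_end occ i}" by simp
  then show "split_at occ i j \<in> occ" using e(3) by blast
qed

lemma run_labelling_split:
  assumes "run_labelling n occ \<beta> w" "(i, j) \<in> run_pairs occ"
  shows "\<exists>\<beta>'. run_labelling n (occ - {split_at occ i j}) \<beta>' (w \<circ> transpose (\<beta> i) (\<beta> j))"
proof -
  note d = run_pairsD[OF run_labelling_finite[OF assms(1)] assms(2)]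
  show ?thesis
    by (rule exI[where x = "\<beta> \<circ> swap_segments i j (split_at occ i j) (run_end occ i)"])
      (rule run_labelling_descend[OF assms(1) d(1,2) refl d(5)])
qed

lemma run_labelling_reflection:
  assumes m: "run_labelling n occ \<beta> w" and ij: "i \<in> {1..n + 1}" "j \<in> {1..n + 1}" "i \<noteq> j"
  shows "\<beta> i \<in> {1..n + 1}" "\<beta> j \<in> {1..n + 1}" "transpose (\<beta> i) (\<beta> j) \<in> reflections n"
proof -
  have \<beta>: "\<beta> permutes {1..n + 1}" using run_labellingD(4)[OF m] .
  show 1: "\<beta> i \<in> {1..n + 1}" "\<beta> j \<in> {1..n + 1}"
    using ij(1,2) permutes_in_image[OF \<beta>] by blast+
  have "\<beta> i \<noteq> \<beta> j" using ij(3) permutes_inj[OF \<beta>] by (simp add: inj_eq)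
  then show "transpose (\<beta> i) (\<beta> j) \<in> reflections n" using reflectionI 1 by blast
qed

lemma run_pairs_range:
  assumes m: "run_labelling n occ \<beta> w" and ij: "(i, j) \<in> run_pairs occ"
  shows "i \<in> {1..n + 1}" "j \<in> {1..n + 1}" "i < j"
proof -
  have "i < j" "{i..<j} \<subseteq> {1..n}" using run_labellingD(1)[OF m] ij unfolding run_pairs_def by auto
  moreover from this have "i \<in> {1..n}" "j - 1 \<in> {1..n}"
    using subsetD[of "{i..<j}" "{1..n}"] by simp_all
  ultimately show "i \<in> {1..n + 1}" "j \<in> {1..n + 1}" "i < j" by auto
qed

text \<open>
  The colouring argument gives one inequality; for the other one, splitting a cycle releases one
  space and costs one reflection.
\<close>

lemma run_labelling_refl_len:
  assumes "run_labelling n occ \<beta> w"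
  shows "refl_len n w = card occ"
  using assms
proof (induction "card occ" arbitrary: occ \<beta> w)
  case 0
  then have "w = id" using run_labelling_empty run_labelling_finite by fastforce
  then show ?case using refl_len_id 0 by metis
next
  case (Suc k)
  note m = Suc.prems
  have fin: "finite occ" using run_labelling_finite m .
  then obtain i where i: "i \<in> occ" using Suc(2) by fastforce
  \<comment> \<open>splitting off the end of the run releases \<open>i\<close> itself, because \<open>i + e - j = i\<close> for \<open>j = e\<close>\<close>
  let ?j = "run_end occ i"
  have ne: "i \<noteq> ?j" using run_end(2)[OF fin, of i] i by metis
  then have ij: "(i, ?j) \<in> run_pairs occ"
    using run_end[OF fin, of i] unfolding run_pairs_def by simp
  let ?t = "transpose (\<beta> i) (\<beta> ?j)"
  have p: "split_at occ i ?j = i" unfolding split_at_def by simp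
  obtain \<beta>' where m': "run_labelling n (occ - {i}) \<beta>' (w \<circ> ?t)"
    using run_labelling_split[OF m ij] p by auto
  have len': "refl_len n (w \<circ> ?t) = k"
    using Suc(1)[OF _ m'] Suc(2) i fin by (metis card_Diff_singleton diff_Suc_1)
  have t: "?t \<in> reflections n"
    using run_labelling_reflection(3)[OF m] run_pairs_range[OF m ij] ne by blast
  have wt: "w \<circ> ?t \<in> Sym n" using run_labellingD(2)[OF m'] .
  have "w = (w \<circ> ?t) \<circ> ?t" by (simp add: comp_assoc)
  moreover have "refl_len n ((w \<circ> ?t) \<circ> ?t) \<le> k + 1"
    using refl_len_comp[OF wt, of ?t] t refl_len_refl[OF t] len' reflections_subset_Sym by fastforce
  ultimately have "refl_len n w \<le> k + 1" by simp
  moreover have "card occ \<le> refl_len n w"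
  proof -
    have "w \<in> Sym n" using run_labellingD(2)[OF m] .
    then obtain us where "set us \<subseteq> reflections n" "length us = refl_len n w" "word_prod us = w"
      using refl_word by blast
    then show ?thesis using run_labelling_word_length[OF m] by metis
  qed
  ultimately show ?case using Suc(2) by simp
qed

lemma run_labelling_refl_step:
  assumes "run_labelling n occ \<beta> w" "(i, j) \<in> run_pairs occ"
  shows "refl_step n (w \<circ> transpose (\<beta> i) (\<beta> j)) w"
proof -
  obtain \<beta>' where m': "run_labelling n (occ - {split_at occ i j}) \<beta>' (w \<circ> transpose (\<beta> i) (\<beta> j))"
    using run_labelling_split assms by blast
  have fin: "finite occ" using run_labelling_finite assms by blast
  have "split_at occ i j \<in> occ" using run_pairsD(8) fin assms by blast
  then have "card occ = Suc (card (occ - {split_at occ i j}))" using fin by (metis card_Suc_Diff1)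
  moreover have "transpose (\<beta> i) (\<beta> j) \<in> reflections n"
    using run_labelling_reflection(3)[OF assms(1)] run_pairs_range[OF assms] by blast
  ultimately show ?thesis
    using run_labelling_refl_len[OF m'] run_labelling_refl_len[OF assms(1)] run_labellingD(2)[OF assms(1)]
    unfolding refl_step_def by auto
qed

text \<open>
  Append the reflection \<open>t\<close> to a reduced word for \<open>u\<close>. The result is a reduced word for \<open>w\<close>, so
  its invariant colouring has as many colours as \<open>w\<close> has cycles and therefore separates them.
  Since \<open>t\<close> preserves colours, it interchanges two elements of the same cycle.
\<close>

lemma refl_step_run_labelling:
  assumes m: "run_labelling n occ \<beta> w" and st: "refl_step n u w"
  shows "\<exists>i j. (i, j) \<in> run_pairs occ \<and> u = w \<circ> transpose (\<beta> i) (\<beta> j)"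
proof -
  have fin: "finite occ" using run_labelling_finite m .
  obtain t where t: "t \<in> reflections n" "u = w \<circ> t" and w: "w \<in> Sym n"
    and len: "refl_len n w = Suc (refl_len n u)"
    using st unfolding refl_step_def by blast
  obtain a b where ab: "t = transpose a b" "a \<in> {1..n + 1}" "b \<in> {1..n + 1}" "a \<noteq> b"
    using t unfolding reflections_def by auto
  have \<beta>: "\<beta> permutes {1..n + 1}" using run_labellingD(4)[OF m] .
  obtain i' j' where ij': "i' \<in> {1..n + 1}" "j' \<in> {1..n + 1}" "a = \<beta> i'" "b = \<beta> j'"
    using permutes_image[OF \<beta>] ab by (metis imageE)
  \<comment> \<open>a transposition does not determine the order of its two points\<close>
  define i j where "i = min i' j'" and "j = max i' j'"
  have "i' \<noteq> j'" using ij' ab by auto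
  then have ij: "i < j" "i \<in> {1..n + 1}" "j \<in> {1..n + 1}" and t_eq: "t = transpose (\<beta> i) (\<beta> j)"
    using ij' ab by (auto simp: i_def j_def min_def max_def transpose_commute)
  have "u \<in> Sym n" using w t reflections_subset_Sym Sym_comp by blast
  then obtain us where us: "set us \<subseteq> reflections n" "length us = refl_len n u" "word_prod us = u"
    using refl_word by blast
  have "word_prod (us @ [t]) = w"
    using us t reflection_involution[OF t(1)] by (simp add: word_prod_append comp_assoc)
  moreover have "set (us @ [t]) \<subseteq> reflections n" using us t by simp
  ultimately obtain f :: "nat \<Rightarrow> nat" where f: "\<And>s x. s \<in> set (us @ [t]) \<Longrightarrow> f (s x) = f x"
    "\<And>z. f (\<beta> z) = f (\<beta> (run_end occ z))"
    "n + 1 \<le> card ((\<lambda>z. f (\<beta> z)) ` ({1..n + 1} - occ)) + length (us @ [t])"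
    using run_labelling_word[OF m] by metis
  have "length (us @ [t]) = card occ" using us len run_labelling_refl_len[OF m] by simp
  then have "card ({1..n + 1} - occ) \<le> card ((\<lambda>z. f (\<beta> z)) ` ({1..n + 1} - occ))"
    using f(3) run_labelling_card_run_ends[OF m] by simp
  then have inj: "inj_on (\<lambda>z. f (\<beta> z)) ({1..n + 1} - occ)"
    by (intro eq_card_imp_inj_on) (auto intro: antisym card_image_le)
  have range: "run_end occ z \<in> {1..n + 1} - occ" if "z \<in> {1..n + 1}" for z
  proof -
    have "n + 1 \<notin> occ" using run_labellingD(1)[OF m] by auto
    then have "run_end occ z \<le> n + 1" using that unfolding run_end_def by (intro Least_le) auto
    then show ?thesis using run_end[OF fin, of z] that by auto
  qed
  have "f (\<beta> j) = f (\<beta> i)" using f(1)[of t "\<beta> i"] t_eq by simp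
  then have "f (\<beta> (run_end occ i)) = f (\<beta> (run_end occ j))" using f(2) by metis
  then have "run_end occ i = run_end occ j" using inj range ij by (meson inj_onD)
  then have "(i, j) \<in> run_pairs occ"
    using run_end_eq_iff[OF fin, of i j] ij unfolding run_pairs_def by auto
  then show ?thesis using t t_eq by blast
qed

lemma run_labelling_transpose_inj:
  assumes m: "run_labelling n occ \<beta> w" and "(i, j) \<in> run_pairs occ" "(k, l) \<in> run_pairs occ"
    and eq: "w \<circ> transpose (\<beta> i) (\<beta> j) = w \<circ> transpose (\<beta> k) (\<beta> l)"
  shows "i = k \<and> j = l"
proof -
  have inj: "inj w" "inj \<beta>"
    using run_labellingD(2,3)[OF m] by (simp_all add: Sym_def permutes_inj)
  have "transpose (\<beta> i) (\<beta> j) x = transpose (\<beta> k) (\<beta> l) x" for x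
    using fun_cong[OF eq, of x] inj(1) by (simp add: inj_eq)
  from this[of "\<beta> i"] this[of "\<beta> j"]
  show ?thesis
    using inj(2) run_pairs_range(3)[OF m assms(2)] run_pairs_range(3)[OF m assms(3)]
    by (auto simp: transpose_def inj_eq split: if_splits)
qed

text \<open>
  Inside a block \<open>w\<close> preserves the order except that it sends the maximum to the minimum. So the
  order of the two values is reversed exactly when \<open>j\<close> is the last position of the cycle, and
  this means that the car parks at its preference \<open>i\<close>.
\<close>

lemma run_labelling_bruhat_iff:
  assumes m: "run_labelling n occ \<beta> w" and ij: "(i, j) \<in> run_pairs occ"
  shows "bruhat_less n w (w \<circ> transpose (\<beta> i) (\<beta> j)) \<longleftrightarrow> split_at occ i j \<noteq> i"
proof -
  have fin: "finite occ" using run_labelling_finite m .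
  note r = run_pairs_range[OF m ij] and d = run_pairsD[OF fin ij]
  have "\<beta> i < \<beta> j" using run_labelling_mono[OF m] d by blast
  moreover have "\<beta> i \<in> {1..n + 1}" "\<beta> j \<in> {1..n + 1}" using run_labelling_reflection(1,2)[OF m r(1,2)] r(3) by simp_all
  moreover have "w \<in> Sym n" using run_labellingD(2)[OF m] .
  ultimately have iff: "bruhat_less n w (w \<circ> transpose (\<beta> i) (\<beta> j)) \<longleftrightarrow> w (\<beta> i) < w (\<beta> j)"
    using bruhat_less_transpose_iff by blast
  have wi: "w (\<beta> i) = \<beta> (Suc i)" using run_labelling_apply[OF m] run_cycles_in d by metis
  note e = run_end[OF fin, of i]
  show ?thesis
  proof (cases "j = run_end occ i")
    case True
    then have "split_at occ i j = i" unfolding split_at_def by simp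
    have jo: "j \<notin> occ" using True e by simp
    let ?x = "run_cycles occ j"
    have x: "{?x..<j} \<subseteq> occ" "?x = 0 \<or> ?x - 1 \<notin> occ" "?x \<le> j" using run_cycles_out jo by auto
    have "?x \<le> i"
    proof (rule ccontr)
      assume "\<not> ?x \<le> i"
      then have x': "?x - 1 \<in> {i..<j}" "?x \<noteq> 0" using x(3) by auto
      show False using x(2) x'(2) subsetD[OF d(2) x'(1)] by simp
    qed
    moreover have "{?x..<Suc i} \<subseteq> {?x..<j}" using d(1) by auto
    ultimately have "\<beta> ?x < \<beta> (Suc i)" using x(1) by (intro run_labelling_mono[OF m]) auto
    then show ?thesis using iff wi run_labelling_apply[OF m, of j] \<open>split_at occ i j = i\<close> by simp
  next
    case False
    then have "j \<in> {i..<run_end occ i}" using d by simp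
    then have jo: "j \<in> occ" using e by blast
    have "{Suc i..<Suc j} \<subseteq> insert j {i..<j}" by auto
    then have "{Suc i..<Suc j} \<subseteq> occ" using d jo by auto
    then have "\<beta> (Suc i) < \<beta> (Suc j)" using run_labelling_mono[OF m, of "Suc i" "Suc j"] d by simp
    moreover have "w (\<beta> j) = \<beta> (Suc j)" using run_labelling_apply[OF m] run_cycles_in jo by metis
    moreover have "split_at occ i j \<noteq> i" using False d by auto
    ultimately show ?thesis using iff wi by simp
  qed
qed

section \<open>Parking outcomes and the bijection\<close>

lemma length_park_cars [simp]: "length (park_cars n occ \<alpha>) = length \<alpha>"
  by (induction \<alpha> arbitrary: occ) auto

lemma park_cars_append:
  "park_cars n occ (\<alpha> @ \<beta>) =
     park_cars n occ \<alpha> @ park_cars n (occ \<union> {p. Some p \<in> set (park_cars n occ \<alpha>)}) \<beta>"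
proof (induction \<alpha> arbitrary: occ)
  case (Cons a \<alpha>)
  have "occ \<union> set_option (park_at n occ a) \<union>
      {p. Some p \<in> set (park_cars n (occ \<union> set_option (park_at n occ a)) \<alpha>)} =
    occ \<union> {p. Some p \<in> set (park_cars n occ (a # \<alpha>))}"
    by (auto dest: sym)
  then show ?case using Cons by simp
qed simp

lemma park_at_eq_Some_iff:
  assumes "1 \<le> a"
  shows "park_at n occ a = Some p \<longleftrightarrow> p \<in> {1..n} - occ \<and> a \<le> p \<and> {a..<p} \<subseteq> occ"
proof
  assume L: "park_at n occ a = Some p"
  let ?P = "\<lambda>p. p \<in> {1..n} - occ \<and> a \<le> p"
  have ex: "\<exists>p. ?P p" and p: "p = (LEAST p. ?P p)"
    using L unfolding park_at_def by (auto split: if_splits)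
  from LeastI_ex[OF ex] have Pp: "?P p" using p by simp
  have "x \<in> occ" if "x \<in> {a..<p}" for x
    using not_less_Least[of x ?P] p that Pp assms by auto
  then show "p \<in> {1..n} - occ \<and> a \<le> p \<and> {a..<p} \<subseteq> occ" using Pp by blast
next
  assume R: "p \<in> {1..n} - occ \<and> a \<le> p \<and> {a..<p} \<subseteq> occ"
  have "(LEAST p. p \<in> {1..n} - occ \<and> a \<le> p) = p"
  proof (rule Least_equality)
    show "p \<le> y" if "y \<in> {1..n} - occ \<and> a \<le> y" for y
    proof (rule ccontr)
      assume "\<not> p \<le> y"
      then have "y \<in> {a..<p}" using that by simp
      then show False using R that by blast
    qed
  qed (use R in blast)
  moreover have "\<exists>p\<in>{1..n} - occ. a \<le> p" using R by blast
  ultimately show "park_at n occ a = Some p" unfolding park_at_def by presburger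
qed

text \<open>
  Preference lists for which all cars park and occupy exactly \<open>occ\<close>. The number of cars is
  determined by \<open>occ\<close>, see \<open>parkings_length\<close>.
\<close>

definition parkings :: "nat \<Rightarrow> nat set \<Rightarrow> nat list set" where
  "parkings n occ = {\<alpha>. set \<alpha> \<subseteq> {1..n} \<and> None \<notin> set (park_cars n {} \<alpha>) \<and>
     {p. Some p \<in> set (park_cars n {} \<alpha>)} = occ}"

lemma parkings_empty: "parkings n {} = {[]}"
proof -
  have "\<alpha> = []" if "\<alpha> \<in> parkings n {}" for \<alpha>
  proof (rule ccontr)
    assume "\<alpha> \<noteq> []"
    then obtain x where "x \<in> set (park_cars n {} \<alpha>)"
      by (metis length_greater_0_conv length_park_cars nth_mem)
    moreover have "None \<notin> set (park_cars n {} \<alpha>)" "\<And>p. Some p \<notin> set (park_cars n {} \<alpha>)"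
      using that unfolding parkings_def by blast+
    ultimately show False by (metis option.exhaust)
  qed
  then show ?thesis by (auto simp: parkings_def)
qed

lemma park_cars_snoc:
  assumes "\<alpha> \<in> parkings n occ"
  shows "park_cars n {} (\<alpha> @ [a]) = park_cars n {} \<alpha> @ [park_at n occ a]"
  using assms unfolding parkings_def by (simp add: park_cars_append)

lemma parkings_snoc_iff:
  "\<alpha> @ [a] \<in> parkings n occ \<longleftrightarrow>
     (\<exists>p\<in>occ. a \<in> {1..n} \<and> \<alpha> \<in> parkings n (occ - {p}) \<and> park_at n (occ - {p}) a = Some p)"
  (is "?L \<longleftrightarrow> ?R")
proof
  assume L: ?L
  define occ' where "occ' = {p. Some p \<in> set (park_cars n {} \<alpha>)}"
  have pc: "park_cars n {} (\<alpha> @ [a]) = park_cars n {} \<alpha> @ [park_at n occ' a]"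
    by (simp add: park_cars_append occ'_def)
  then have \<alpha>: "\<alpha> \<in> parkings n occ'" using L by (auto simp: parkings_def occ'_def)
  obtain p where p: "park_at n occ' a = Some p" using L pc by (cases "park_at n occ' a") (auto simp: parkings_def)
  have a: "a \<in> {1..n}" using L by (simp add: parkings_def)
  then have "p \<notin> occ'" using p park_at_eq_Some_iff[of a n occ' p] by auto
  moreover have "occ = insert p occ'" using L pc p unfolding parkings_def occ'_def by auto
  ultimately show ?R using \<alpha> p a by auto
next
  assume ?R
  then obtain p where p: "p \<in> occ" "a \<in> {1..n}" "\<alpha> \<in> parkings n (occ - {p})"
    "park_at n (occ - {p}) a = Some p" by blast
  have "{q. Some q \<in> set (park_cars n {} (\<alpha> @ [a]))} = insert p (occ - {p})"
    using park_cars_snoc[OF p(3), of a] p(3,4) unfolding parkings_def by auto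
  then show ?L using park_cars_snoc[OF p(3), of a] p unfolding parkings_def by auto
qed

lemma parkings_subset: "\<alpha> \<in> parkings n occ \<Longrightarrow> occ \<subseteq> {1..n}"
proof (induction \<alpha> arbitrary: occ rule: rev_induct)
  case Nil
  then show ?case by (auto simp: parkings_def)
next
  case (snoc a \<alpha>)
  then obtain p where p: "p \<in> occ" "a \<in> {1..n}" "\<alpha> \<in> parkings n (occ - {p})"
    "park_at n (occ - {p}) a = Some p" using parkings_snoc_iff by blast
  then have "occ - {p} \<subseteq> {1..n}" "p \<in> {1..n}"
    using snoc.IH park_at_eq_Some_iff[of a n "occ - {p}" p] by auto
  then show ?case by blast
qed

lemma parkings_length: "\<alpha> \<in> parkings n occ \<Longrightarrow> length \<alpha> = card occ"
proof (induction \<alpha> arbitrary: occ rule: rev_induct)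
  case Nil
  then show ?case by (auto simp: parkings_def)
next
  case (snoc a \<alpha>)
  then obtain p where p: "p \<in> occ" "\<alpha> \<in> parkings n (occ - {p})" using parkings_snoc_iff by blast
  have "finite occ" using parkings_subset[OF snoc.prems] by (rule finite_subset) simp
  from card_Suc_Diff1[OF this p(1)] show ?case using snoc.IH[OF p(2)] by simp
qed

lemma parking_functions_eq_parkings: "parking_functions n = parkings n {1..n}"
proof (intro equalityI subsetI)
  fix \<alpha> assume "\<alpha> \<in> parkings n {1..n}"
  then show "\<alpha> \<in> parking_functions n"
    using parkings_length[of \<alpha> n "{1..n}"] by (simp add: parkings_def parking_functions_def)
next
  fix \<alpha> assume \<alpha>: "\<alpha> \<in> parking_functions n"
  define occ where "occ = {p. Some p \<in> set (park_cars n {} \<alpha>)}"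
  have p: "\<alpha> \<in> parkings n occ" using \<alpha> by (simp add: parkings_def parking_functions_def occ_def)
  have "card occ = n" using parkings_length[OF p] \<alpha> by (simp add: parking_functions_def)
  then have "occ = {1..n}" using parkings_subset[OF p] by (intro card_subset_eq) auto
  then show "\<alpha> \<in> parkings n {1..n}" using p by simp
qed

lemma park_at_split_at:
  assumes sub: "occ \<subseteq> {1..n}" and ij: "(i, j) \<in> run_pairs occ"
  shows "park_at n (occ - {split_at occ i j}) i = Some (split_at occ i j)"
proof -
  have fin: "finite occ" using sub by (rule finite_subset) simp
  note d = run_pairsD[OF fin ij]
  have "{i..<split_at occ i j} \<subseteq> {i..<run_end occ i}" using d(7) by auto
  then have "{i..<split_at occ i j} \<subseteq> occ - {split_at occ i j}" using run_end(3)[OF fin, of i] by auto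
  moreover have "1 \<le> i" using d(4) sub by auto
  ultimately show ?thesis using park_at_eq_Some_iff[of i n] d sub by auto
qed

text \<open>
  A last car with preference \<open>i\<close> can occupy every space of the run from \<open>i\<close> on, and no other.
\<close>

lemma parkings_decompose:
  assumes sub: "occ \<subseteq> {1..n}" and ne: "occ \<noteq> {}"
  shows "parkings n occ =
    (\<Union>x\<in>run_pairs occ. (\<lambda>\<alpha>. \<alpha> @ [fst x]) ` parkings n (occ - {split_at occ (fst x) (snd x)}))"
proof (intro equalityI subsetI)
  have fin: "finite occ" using sub by (rule finite_subset) simp
  fix y assume y: "y \<in> parkings n occ"
  have "y \<noteq> []" using parkings_length[OF y] ne fin by auto
  then obtain \<alpha> a where ya: "y = \<alpha> @ [a]" by (metis rev_exhaust)
  then obtain p where p: "p \<in> occ" "a \<in> {1..n}" "\<alpha> \<in> parkings n (occ - {p})"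
    "park_at n (occ - {p}) a = Some p" using y parkings_snoc_iff by blast
  then have ap: "a \<le> p" "{a..<p} \<subseteq> occ" using park_at_eq_Some_iff[of a n "occ - {p}" p] by auto
  let ?e = "run_end occ a"
  note e = run_end[OF fin, of a]
  have pe: "p < ?e"
  proof (rule ccontr)
    assume "\<not> p < ?e"
    moreover have "p \<noteq> ?e" using p(1) e(2) by metis
    ultimately have "?e \<in> {a..<p}" using e(1) by simp
    then show False using ap(2) e(2) by blast
  qed
  let ?j = "a + ?e - p"
  have "{a..<?j} \<subseteq> {a..<?e}" using ap(1) by auto
  then have "(a, ?j) \<in> run_pairs occ"
    using pe e(3) unfolding run_pairs_def by auto
  moreover have "split_at occ a ?j = p" using pe ap(1) unfolding split_at_def by simp
  ultimately show "y \<in> (\<Union>x\<in>run_pairs occ. (\<lambda>\<alpha>. \<alpha> @ [fst x]) `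
      parkings n (occ - {split_at occ (fst x) (snd x)}))"
    using p(3) ya by (intro UN_I[of "(a, ?j)"]) auto
next
  have fin: "finite occ" using sub by (rule finite_subset) simp
  fix y assume "y \<in> (\<Union>x\<in>run_pairs occ. (\<lambda>\<alpha>. \<alpha> @ [fst x]) `
      parkings n (occ - {split_at occ (fst x) (snd x)}))"
  then obtain i j \<alpha> where y: "(i, j) \<in> run_pairs occ" "y = \<alpha> @ [i]"
    "\<alpha> \<in> parkings n (occ - {split_at occ i j})" by auto
  then show "y \<in> parkings n occ"
    unfolding y(2) parkings_snoc_iff
    using park_at_split_at[OF sub y(1)] run_pairsD(4,8)[OF fin y(1)] sub by blast
qed

lemma refl_chains_id: "refl_chains n id = {[id]}"
proof -
  have "ws = [id]" if ws: "ws \<in> refl_chains n id" for ws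
  proof -
    have "length ws = 1" "hd ws = id"
      using refl_chains_length[OF ws] ws unfolding refl_len_id refl_chains_def by simp_all
    then show ?thesis by (cases ws) auto
  qed
  moreover have "[id] \<in> refl_chains n id" unfolding refl_chains_def by simp
  ultimately show ?thesis by blast
qed

lemma refl_chains_snoc:
  assumes "w \<noteq> id"
  shows "refl_chains n w = (\<Union>u\<in>{u. refl_step n u w}. (\<lambda>ws. ws @ [w]) ` refl_chains n u)"
proof (intro equalityI subsetI)
  fix ws assume ws: "ws \<in> refl_chains n w"
  then obtain vs where vs: "ws = vs @ [w]"
    unfolding refl_chains_def by (metis (mono_tags) mem_Collect_eq append_butlast_last_id)
  have "vs \<noteq> []" using ws vs assms unfolding refl_chains_def by auto
  then have "vs \<in> refl_chains n (last vs)" "refl_step n (last vs) w"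
    using ws vs unfolding refl_chains_def by (auto simp: successively_append_iff)
  then show "ws \<in> (\<Union>u\<in>{u. refl_step n u w}. (\<lambda>ws. ws @ [w]) ` refl_chains n u)"
    using vs by blast
next
  fix ws assume "ws \<in> (\<Union>u\<in>{u. refl_step n u w}. (\<lambda>ws. ws @ [w]) ` refl_chains n u)"
  then obtain u vs where "refl_step n u w" "vs \<in> refl_chains n u" "ws = vs @ [w]" by blast
  then show "ws \<in> refl_chains n w"
    unfolding refl_chains_def by (auto simp: successively_append_iff)
qed

lemma refl_chains_decompose:
  assumes m: "run_labelling n occ \<beta> w" and ne: "occ \<noteq> {}"
  shows "refl_chains n w =
    (\<Union>x\<in>run_pairs occ. (\<lambda>ws. ws @ [w]) ` refl_chains n (w \<circ> transpose (\<beta> (fst x)) (\<beta> (snd x))))"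
proof -
  have "refl_len n w \<noteq> 0" using run_labelling_refl_len[OF m] run_labelling_finite[OF m] ne by simp
  then have "w \<noteq> id" using refl_len_id by metis
  moreover have "{u. refl_step n u w} =
      (\<lambda>x. w \<circ> transpose (\<beta> (fst x)) (\<beta> (snd x))) ` run_pairs occ"
    using refl_step_run_labelling[OF m] run_labelling_refl_step[OF m] by force
  ultimately show ?thesis using refl_chains_snoc by simp
qed

text \<open>
  Both sets are disjoint unions over \<open>run_pairs occ\<close>, according to the last car and to the
  element covered by \<open>w\<close>. The parts with the same index are related by a smaller instance, and
  the last car is reluctant exactly when the last edge is bad; so the bijections of the parts
  fit together. The indices of cars and of chain members both count from the bottom, so they are
  unaffected by the last step.
\<close>

theorem parkings_refl_chains_bij:
  assumes "run_labelling n occ \<beta> w"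
  shows "\<exists>h. bij_betw h (parkings n occ) (refl_chains n w) \<and>
    (\<forall>\<alpha>\<in>parkings n occ. \<forall>k<length \<alpha>.
       (\<exists>p. park_cars n {} \<alpha> ! k = Some p \<and> p \<noteq> \<alpha> ! k) \<longleftrightarrow>
       bruhat_less n (h \<alpha> ! Suc k) (h \<alpha> ! k))"
  using assms
proof (induction "card occ" arbitrary: occ \<beta> w)
  case 0
  then have occ: "occ = {}" using run_labelling_finite by fastforce
  then have w: "w = id" using run_labelling_empty 0 by blast
  have "bij_betw (\<lambda>_. [id]) (parkings n occ) (refl_chains n w)"
    unfolding occ w parkings_empty refl_chains_id by (simp add: bij_betw_def)
  then show ?case unfolding occ parkings_empty by (intro exI[of _ "\<lambda>_. [id]"]) simp
next
  case (Suc m)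
  note mo = Suc.prems
  have sub: "occ \<subseteq> {1..n}" and fin: "finite occ" using run_labellingD[OF mo] run_labelling_finite[OF mo] by auto
  have ne: "occ \<noteq> {}" using Suc(2) by auto
  define sp where "sp x = split_at occ (fst x) (snd x)" for x
  define t where "t x = w \<circ> transpose (\<beta> (fst x)) (\<beta> (snd x))" for x
  have "\<forall>x\<in>run_pairs occ. \<exists>h. bij_betw h (parkings n (occ - {sp x})) (refl_chains n (t x)) \<and>
    (\<forall>\<alpha>\<in>parkings n (occ - {sp x}). \<forall>k<length \<alpha>.
       (\<exists>p. park_cars n {} \<alpha> ! k = Some p \<and> p \<noteq> \<alpha> ! k) \<longleftrightarrow>
       bruhat_less n (h \<alpha> ! Suc k) (h \<alpha> ! k))"
  proof
    fix x assume x: "x \<in> run_pairs occ"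
    then obtain \<beta>' where m': "run_labelling n (occ - {sp x}) \<beta>' (t x)"
      using run_labelling_split[OF mo, of "fst x" "snd x"] unfolding sp_def t_def by auto
    have "sp x \<in> occ" using run_pairsD(8)[OF fin, of "fst x" "snd x"] x unfolding sp_def by simp
    then have "m = card (occ - {sp x})" using Suc(2) fin by simp
    from Suc(1)[OF this m'] show "\<exists>h. bij_betw h (parkings n (occ - {sp x})) (refl_chains n (t x)) \<and>
      (\<forall>\<alpha>\<in>parkings n (occ - {sp x}). \<forall>k<length \<alpha>.
         (\<exists>p. park_cars n {} \<alpha> ! k = Some p \<and> p \<noteq> \<alpha> ! k) \<longleftrightarrow>
         bruhat_less n (h \<alpha> ! Suc k) (h \<alpha> ! k))" .
  qed
  from bchoice[OF this] obtain H where
    H: "\<And>x. x \<in> run_pairs occ \<Longrightarrow> bij_betw (H x) (parkings n (occ - {sp x})) (refl_chains n (t x))"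
    and lab: "\<And>x \<alpha> k. x \<in> run_pairs occ \<Longrightarrow> \<alpha> \<in> parkings n (occ - {sp x}) \<Longrightarrow> k < length \<alpha> \<Longrightarrow>
       (\<exists>p. park_cars n {} \<alpha> ! k = Some p \<and> p \<noteq> \<alpha> ! k) \<longleftrightarrow>
       bruhat_less n (H x \<alpha> ! Suc k) (H x \<alpha> ! k)"
    by blast
  define A where "A x = (\<lambda>\<alpha>. \<alpha> @ [fst x]) ` parkings n (occ - {sp x})" for x
  define B where "B x = (\<lambda>ws. ws @ [w]) ` refl_chains n (t x)" for x
  \<comment> \<open>the index of a list is read off from the preference and the space of the last car\<close>
  define idx where "idx y = (last y, last y + run_end occ (last y) - the (last (park_cars n {} y)))"
    for y
  define h where "h y = H (idx y) (butlast y) @ [w]" for y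
  have last_car: "park_cars n {} (\<alpha> @ [fst x]) = park_cars n {} \<alpha> @ [Some (sp x)]"
    if "x \<in> run_pairs occ" "\<alpha> \<in> parkings n (occ - {sp x})" for x \<alpha>
    using park_cars_snoc[OF that(2)] park_at_split_at[OF sub, of "fst x" "snd x"] that(1)
    unfolding sp_def by simp
  have idx: "idx (\<alpha> @ [fst x]) = x"
    if "x \<in> run_pairs occ" "\<alpha> \<in> parkings n (occ - {sp x})" for x \<alpha>
    using last_car[OF that] run_pairsD(5)[OF fin, of "fst x" "snd x"] that(1)
    unfolding idx_def sp_def by (simp add: prod_eq_iff)
  have h: "h (\<alpha> @ [fst x]) = H x \<alpha> @ [w]"
    if "x \<in> run_pairs occ" "\<alpha> \<in> parkings n (occ - {sp x})" for x \<alpha>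
    unfolding h_def idx[OF that] by simp
  have "bij_betw h (A x) (B x)" if x: "x \<in> run_pairs occ" for x
  proof -
    have "inj_on h (A x)"
    proof (rule inj_onI)
      fix y z assume "y \<in> A x" "z \<in> A x" and eq: "h y = h z"
      then obtain \<alpha> \<alpha>' where "\<alpha> \<in> parkings n (occ - {sp x})" "y = \<alpha> @ [fst x]"
        "\<alpha>' \<in> parkings n (occ - {sp x})" "z = \<alpha>' @ [fst x]" unfolding A_def by blast
      then show "y = z" using eq h[OF x] bij_betw_imp_inj_on[OF H[OF x]] by (auto dest: inj_onD)
    qed
    moreover have "h ` A x = (\<lambda>ws. ws @ [w]) ` (H x ` parkings n (occ - {sp x}))"
      unfolding A_def image_image using h[OF x] by (intro image_cong) auto
    ultimately show ?thesis
      using bij_betw_imp_surj_on[OF H[OF x]] unfolding bij_betw_def B_def by simp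
  qed
  moreover have "disjoint_family_on B (run_pairs occ)"
    unfolding disjoint_family_on_def
  proof (intro ballI impI)
    fix x y assume xy: "x \<in> run_pairs occ" "y \<in> run_pairs occ" "x \<noteq> y"
    show "B x \<inter> B y = {}"
    proof (rule ccontr)
      assume "B x \<inter> B y \<noteq> {}"
      then obtain ws where "ws \<in> refl_chains n (t x)" "ws \<in> refl_chains n (t y)"
        unfolding B_def by auto
      then have "t x = t y" unfolding refl_chains_def by auto
      then show False
        using run_labelling_transpose_inj[OF mo, of "fst x" "snd x" "fst y" "snd y"] xy
        unfolding t_def by (auto simp: prod_eq_iff)
    qed
  qed
  ultimately have "bij_betw h (\<Union>x\<in>run_pairs occ. A x) (\<Union>x\<in>run_pairs occ. B x)"
    by (rule bij_betw_UNION_disjoint[rotated])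
  then have "bij_betw h (parkings n occ) (refl_chains n w)"
    using parkings_decompose[OF sub ne] refl_chains_decompose[OF mo ne]
    unfolding A_def B_def sp_def t_def by simp
  moreover have "(\<exists>p. park_cars n {} y ! k = Some p \<and> p \<noteq> y ! k) \<longleftrightarrow>
      bruhat_less n (h y ! Suc k) (h y ! k)"
    if y: "y \<in> parkings n occ" and k: "k < length y" for y k
  proof -
    obtain x \<alpha> where x: "x \<in> run_pairs occ" and \<alpha>: "\<alpha> \<in> parkings n (occ - {sp x})"
      and y_eq: "y = \<alpha> @ [fst x]"
      using y unfolding parkings_decompose[OF sub ne] sp_def by blast
    let ?ws = "H x \<alpha>"
    have ws: "?ws \<in> refl_chains n (t x)" using H[OF x] \<alpha> bij_betwE by blast
    obtain \<beta>' where m': "run_labelling n (occ - {sp x}) \<beta>' (t x)"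
      using run_labelling_split[OF mo, of "fst x" "snd x"] x unfolding sp_def t_def by auto
    have len: "length ?ws = Suc (length \<alpha>)"
      using refl_chains_length[OF ws] run_labelling_refl_len[OF m'] parkings_length[OF \<alpha>] by simp
    show ?thesis
    proof (cases "k < length \<alpha>")
      case True
      then show ?thesis
        using lab[OF x \<alpha> True] last_car[OF x \<alpha>] h[OF x \<alpha>] len
        unfolding y_eq by (simp add: nth_append)
    next
      case False
      then have k: "k = length \<alpha>" using k y_eq by simp
      have "?ws ! k = t x"
        using ws len k unfolding refl_chains_def by (auto simp: last_conv_nth)
      then have "h y ! k = t x" "h y ! Suc k = w"
        using h[OF x \<alpha>] len k unfolding y_eq by (simp_all add: nth_append)
      moreover have "park_cars n {} y ! k = Some (sp x)" "y ! k = fst x"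
        using last_car[OF x \<alpha>] k unfolding y_eq by (simp_all add: nth_append)
      moreover have "bruhat_less n w (t x) \<longleftrightarrow> sp x \<noteq> fst x"
        using run_labelling_bruhat_iff[OF mo, of "fst x" "snd x"] x unfolding t_def sp_def by simp
      ultimately show ?thesis by simp
    qed
  qed
  ultimately show ?case by (intro exI[of _ h]) blast
qed

theorem theorem1p2:
  fixes n :: nat
  assumes "n \<ge> 1"
  shows "\<exists>\<phi> :: nat list \<Rightarrow> (nat \<Rightarrow> nat) list.
    bij_betw \<phi> (parking_functions n) (maximal_chains n (long_cycle n)) \<and>
    (\<forall>\<alpha>\<in>parking_functions n.
       length (\<phi> \<alpha>) = n + 1 \<and> \<phi> \<alpha> ! 0 = id \<and> \<phi> \<alpha> ! n = long_cycle n \<and>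
       (\<forall>i\<in>{1..n}. reluctant \<alpha> i \<longleftrightarrow>
          bad_edge n (long_cycle n) (\<phi> \<alpha> ! (i - 1)) (\<phi> \<alpha> ! i)))"
proof -
  let ?c = "long_cycle n"
  have m: "run_labelling n {1..n} id ?c" by (rule run_labelling_long_cycle)
  have c: "?c \<in> Sym n" using run_labellingD(2)[OF m] .
  obtain h where bij: "bij_betw h (parking_functions n) (refl_chains n ?c)"
    and lab: "\<And>\<alpha> k. \<alpha> \<in> parking_functions n \<Longrightarrow> k < length \<alpha> \<Longrightarrow>
       (\<exists>p. park_cars n {} \<alpha> ! k = Some p \<and> p \<noteq> \<alpha> ! k) \<longleftrightarrow>
       bruhat_less n (h \<alpha> ! Suc k) (h \<alpha> ! k)"
    using parkings_refl_chains_bij[OF m] unfolding parking_functions_eq_parkings by blast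
  have "length (h \<alpha>) = n + 1 \<and> h \<alpha> ! 0 = id \<and> h \<alpha> ! n = ?c \<and>
      (\<forall>i\<in>{1..n}. reluctant \<alpha> i \<longleftrightarrow> bad_edge n ?c (h \<alpha> ! (i - 1)) (h \<alpha> ! i))"
    if \<alpha>: "\<alpha> \<in> parking_functions n" for \<alpha>
  proof -
    have ws: "h \<alpha> \<in> refl_chains n ?c" using bij \<alpha> bij_betwE by blast
    have len: "length (h \<alpha>) = n + 1" using refl_chains_length[OF ws] run_labelling_refl_len[OF m] by simp
    have len\<alpha>: "length \<alpha> = n" using \<alpha> by (simp add: parking_functions_def)
    have "h \<alpha> \<noteq> []" "hd (h \<alpha>) = id" "last (h \<alpha>) = ?c" using ws unfolding refl_chains_def by simp_all
    then have "h \<alpha> ! 0 = id" "h \<alpha> ! n = ?c"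
      using len by (metis hd_conv_nth, metis last_conv_nth add_diff_cancel_right')
    moreover have "reluctant \<alpha> i \<longleftrightarrow> bad_edge n ?c (h \<alpha> ! (i - 1)) (h \<alpha> ! i)" if i: "i \<in> {1..n}" for i
    proof -
      have k: "i - 1 < length \<alpha>" "Suc (i - 1) = i" using i len\<alpha> by auto
      have "edge n ?c (h \<alpha> ! (i - 1)) (h \<alpha> ! i)"
        using refl_chains_edge[OF c ws, of "i - 1"] k len len\<alpha> by simp
      then show ?thesis
        using lab[OF \<alpha> k(1)] k(2) len\<alpha> unfolding reluctant_def bad_edge_def by simp
    qed
    ultimately show ?thesis using len by blast
  qed
  then show ?thesis
    using bij unfolding maximal_chains_eq_refl_chains[OF c] by (intro exI[of _ h]) blast
qed

end
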